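(* (The Column Lemma) Let $n\ge 1$, $\sigma\in S_n$, $m\ge1$, and let $q_1,\dots,q_m,r,s,t_1,\dots,t_m,u,v$ be fixed labels with $r,u\in\{0,+\}$. Then the partition functions of the left column and the right column with these boundary labels are equal: $$L_m(q_1,\dots,q_m;r,s;t_1,\dots,t_m;u,v)=R_m(q_1,\dots,q_m;r,s;t_1,\dots,t_m;u,v)$$ as polynomials in $x_c$.
   Context: **Labels.** Fix $n\ge1$, $\sigma\in S_n$ and an indeterminate $x_c$; $[n]=\{1,\dots,n\}$. Labels are the formal symbols $0$, $+$, $i$, $i^+$ (for $i\in[n]$), and $fg$, $fg^+$ (for $f,g\in[n]$ with $\sigma(f)<\sigma(g)$). **Right-sheared tiles**, edges (left, top, bottom, right), with $i,j,f,g\in[n]$, $i\le j$, $\sigma(f)<\sigma(g)$: $(0,0,0,0)$, $(0,i,0,i)$, $(i,0,i,0)$, $(j,i,j,i)$, $(g,f,f,g)$, $(i,+,+,i)$, $(0,+,+,0)$, $(0,i,+,i^+)$, $(i^+,+,i,0)$, $(j^+,i,j,i^+)$, $(g^+,f,f,g^+)$, all of weight $1$; and $(0,i,i,0)$ of weight $x_c$. **Left-sheared tiles**, edges (top, right, left, bottom), with $i\in[n]$: $(i,0,0,i)$, $(i,i^+,0,+)$, $(+,0,i^+,i)$, $(+,i^+,i^+,+)$, $(i,+,+,i)$, $(0,0,0,0)$, $(0,+,0,+)$, $(+,0,+,0)$, $(+,+,+,+)$, all of weight $1$; and $(+,0,0,+)$ of weight $-x_c$. **Diamond tiles**, edges NW,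 NE, SW, SE, all of weight $1$: (1) $(NW,NE,SW,SE)=(0,0,0,0)$; (2) $(NW,NE)\in\{(0,+)\}\cup\{(i,i^+):i\in[n]\}$ and, independently, $(SW,SE)\in\{(+,0)\}\cup\{(k^+,k):k\in[n]\}$; (3) for some $f\in[n]$: $(NW,NE)\in\{(f,0),(f^+,+)\}\cup\{(g,fg),(g^+,fg^+):\sigma(f)<\sigma(g)\}$ and, independently, $(SW,SE)\in\{(0,f),(+,f^+)\}\cup\{(fh,h),(fh^+,h^+):\sigma(f)<\sigma(h)\}$. **Banned adjacencies.** If $D,D'$ are diamonds with the NE edge of $D$ glued to the SW edge of $D'$, it is forbidden that for some $1\le i<j\le n$ either the shared label is $0$, $NW(D)=i$, $SE(D')=j$; or the shared label is $+$, $NW(D)=i^+$, $SE(D')=j^+$. **Left column.** A tiling of the left column consists of a left-sheared tile $P$, right-sheared tiles $Q_1,\dots,Q_m$ and diamond tiles $D_1,\dots,D_m$ with: $\mathrm{left}(P)=r$, $\mathrm{bottom}(P)=s$, $\mathrm{top}(P)=\mathrm{bottom}(Q_1)$, $\mathrm{right}(P)=SW(D_1)$; for all $i\in[m]$: $\mathrm{left}(Q_i)=q_i$, $\mathrm{right}(Q_i)=NW(D_i)$, $SE(D_i)=t_i$; for $i<m$: $\mathrm{top}(Q_i)=\mathrm{bottom}(Q_{i+1})$, $NE(D_i)=SW(D_{i+1})$; $\mathrm{top}(Q_m)=v$, $NE(D_m)=u$; and no banned adjacency between $D_i,D_{i+1}$. **Right column.** A tiling of the right column consists of diamond tiles $D_1,\dots,D_m$,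 right-sheared tiles $Q_1,\dots,Q_m$ and a left-sheared tile $P$ with: $SW(D_1)=r$, $\mathrm{bottom}(Q_1)=s$; for all $i\in[m]$: $NW(D_i)=q_i$, $SE(D_i)=\mathrm{left}(Q_i)$, $\mathrm{right}(Q_i)=t_i$; for $i<m$: $NE(D_i)=SW(D_{i+1})$, $\mathrm{top}(Q_i)=\mathrm{bottom}(Q_{i+1})$; $NE(D_m)=\mathrm{left}(P)$, $\mathrm{top}(Q_m)=\mathrm{bottom}(P)$, $\mathrm{top}(P)=v$, $\mathrm{right}(P)=u$; and no banned adjacency between $D_i,D_{i+1}$. $L_m$ and $R_m$ denote the sums, over all tilings of the left (resp. right) column with the given boundary labels, of the product of the tile weights. *)

theory Defs
  imports "HOL-Computational_Algebra.Polynomial" "HOL-Combinatorics.Permutations"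
begin

text \<open>The labels \<open>0\<close>, \<open>+\<close>, \<open>i\<close>, \<open>i\<^sup>+\<close>, \<open>fg\<close> and \<open>fg\<^sup>+\<close>. The indices in the datatype
  range over all naturals; \<open>labels n \<sigma>\<close> cuts out the labels belonging to \<open>n\<close> and \<open>\<sigma>\<close>.\<close>

datatype label =
    Zero
  | Plus
  | Ind nat
  | IndP nat
  | Two nat nat
  | TwoP nat nat

inductive_set labels :: "nat \<Rightarrow> (nat \<Rightarrow> nat) \<Rightarrow> label set"
  for n :: nat and \<sigma> :: "nat \<Rightarrow> nat" where
  "Zero \<in> labels n \<sigma>"
| "Plus \<in> labels n \<sigma>"
| "i \<in> {1..n} \<Longrightarrow> Ind i \<in> labels n \<sigma>"
| "i \<in> {1..n} \<Longrightarrow> IndP i \<in> labels n \<sigma>"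
| "f \<in> {1..n} \<Longrightarrow> g \<in> {1..n} \<Longrightarrow> \<sigma> f < \<sigma> g \<Longrightarrow> Two f g \<in> labels n \<sigma>"
| "f \<in> {1..n} \<Longrightarrow> g \<in> {1..n} \<Longrightarrow> \<sigma> f < \<sigma> g \<Longrightarrow> TwoP f g \<in> labels n \<sigma>"

text \<open>Every tile is determined by its edge labels. Note that the order of the edges differs between
  the three kinds of tiles.\<close>

datatype rtile = RTile (rleft: label) (rtop: label) (rbottom: label) (rright: label)

datatype ltile = LTile (ltop: label) (lright: label) (lleft: label) (lbottom: label)

datatype diamond = Diamond (NW: label) (NE: label) (SW: label) (SE: label)

inductive_set rtiles :: "nat \<Rightarrow> (nat \<Rightarrow> nat) \<Rightarrow> rtile set"
  for n :: nat and \<sigma> :: "nat \<Rightarrow> nat" where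
  "RTile Zero Zero Zero Zero \<in> rtiles n \<sigma>"
| "i \<in> {1..n} \<Longrightarrow> RTile Zero (Ind i) Zero (Ind i) \<in> rtiles n \<sigma>"
| "i \<in> {1..n} \<Longrightarrow> RTile (Ind i) Zero (Ind i) Zero \<in> rtiles n \<sigma>"
| "i \<in> {1..n} \<Longrightarrow> j \<in> {1..n} \<Longrightarrow> i \<le> j \<Longrightarrow>
     RTile (Ind j) (Ind i) (Ind j) (Ind i) \<in> rtiles n \<sigma>"
| "f \<in> {1..n} \<Longrightarrow> g \<in> {1..n} \<Longrightarrow> \<sigma> f < \<sigma> g \<Longrightarrow>
     RTile (Ind g) (Ind f) (Ind f) (Ind g) \<in> rtiles n \<sigma>"
| "i \<in> {1..n} \<Longrightarrow> RTile (Ind i) Plus Plus (Ind i) \<in> rtiles n \<sigma>"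
| "RTile Zero Plus Plus Zero \<in> rtiles n \<sigma>"
| "i \<in> {1..n} \<Longrightarrow> RTile Zero (Ind i) Plus (IndP i) \<in> rtiles n \<sigma>"
| "i \<in> {1..n} \<Longrightarrow> RTile (IndP i) Plus (Ind i) Zero \<in> rtiles n \<sigma>"
| "i \<in> {1..n} \<Longrightarrow> j \<in> {1..n} \<Longrightarrow> i \<le> j \<Longrightarrow>
     RTile (IndP j) (Ind i) (Ind j) (IndP i) \<in> rtiles n \<sigma>"
| "f \<in> {1..n} \<Longrightarrow> g \<in> {1..n} \<Longrightarrow> \<sigma> f < \<sigma> g \<Longrightarrow>
     RTile (IndP g) (Ind f) (Ind f) (IndP g) \<in> rtiles n \<sigma>"
| "i \<in> {1..n} \<Longrightarrow> RTile Zero (Ind i) (Ind i) Zero \<in> rtiles n \<sigma>"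

inductive_set ltiles :: "nat \<Rightarrow> ltile set" for n :: nat where
  "i \<in> {1..n} \<Longrightarrow> LTile (Ind i) Zero Zero (Ind i) \<in> ltiles n"
| "i \<in> {1..n} \<Longrightarrow> LTile (Ind i) (IndP i) Zero Plus \<in> ltiles n"
| "i \<in> {1..n} \<Longrightarrow> LTile Plus Zero (IndP i) (Ind i) \<in> ltiles n"
| "i \<in> {1..n} \<Longrightarrow> LTile Plus (IndP i) (IndP i) Plus \<in> ltiles n"
| "i \<in> {1..n} \<Longrightarrow> LTile (Ind i) Plus Plus (Ind i) \<in> ltiles n"
| "LTile Zero Zero Zero Zero \<in> ltiles n"
| "LTile Zero Plus Zero Plus \<in> ltiles n"
| "LTile Plus Zero Plus Zero \<in> ltiles n"
| "LTile Plus Plus Plus Plus \<in> ltiles n"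
| "LTile Plus Zero Zero Plus \<in> ltiles n"

definition x_c :: "int poly" where
  "x_c = [:0, 1:]"

definition rweight :: "rtile \<Rightarrow> int poly" where
  "rweight t = (if \<exists>i. t = RTile Zero (Ind i) (Ind i) Zero then x_c else 1)"

definition lweight :: "ltile \<Rightarrow> int poly" where
  "lweight t = (if t = LTile Plus Zero Zero Plus then - x_c else 1)"

text \<open>Each diamond tile other than the all-zero one combines an admissible pair (NW, NE) with an
  independently chosen admissible pair (SW, SE) of the same family.\<close>

definition upper2 :: "nat \<Rightarrow> (label \<times> label) set" where
  "upper2 n = {(Zero, Plus)} \<union> {(Ind i, IndP i) | i. i \<in> {1..n}}"

definition lower2 :: "nat \<Rightarrow> (label \<times> label) set" where
  "lower2 n = {(Plus, Zero)} \<union> {(IndP k, Ind k) | k. k \<in> {1..n}}"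

definition upper3 :: "nat \<Rightarrow> (nat \<Rightarrow> nat) \<Rightarrow> nat \<Rightarrow> (label \<times> label) set" where
  "upper3 n \<sigma> f = {(Ind f, Zero), (IndP f, Plus)}
     \<union> {(Ind g, Two f g) | g. g \<in> {1..n} \<and> \<sigma> f < \<sigma> g}
     \<union> {(IndP g, TwoP f g) | g. g \<in> {1..n} \<and> \<sigma> f < \<sigma> g}"

definition lower3 :: "nat \<Rightarrow> (nat \<Rightarrow> nat) \<Rightarrow> nat \<Rightarrow> (label \<times> label) set" where
  "lower3 n \<sigma> f = {(Zero, Ind f), (Plus, IndP f)}
     \<union> {(Two f h, Ind h) | h. h \<in> {1..n} \<and> \<sigma> f < \<sigma> h}
     \<union> {(TwoP f h, IndP h) | h. h \<in> {1..n} \<and> \<sigma> f < \<sigma> h}"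

inductive_set diamonds :: "nat \<Rightarrow> (nat \<Rightarrow> nat) \<Rightarrow> diamond set"
  for n :: nat and \<sigma> :: "nat \<Rightarrow> nat" where
  "Diamond Zero Zero Zero Zero \<in> diamonds n \<sigma>"
| "(nw, ne) \<in> upper2 n \<Longrightarrow> (sw, se) \<in> lower2 n \<Longrightarrow> Diamond nw ne sw se \<in> diamonds n \<sigma>"
| "f \<in> {1..n} \<Longrightarrow> (nw, ne) \<in> upper3 n \<sigma> f \<Longrightarrow> (sw, se) \<in> lower3 n \<sigma> f \<Longrightarrow>
     Diamond nw ne sw se \<in> diamonds n \<sigma>"

text \<open>\<open>banned n D D'\<close>: the NE edge of \<open>D\<close> may not be glued to the SW edge of \<open>D'\<close>.\<close>

definition banned :: "nat \<Rightarrow> diamond \<Rightarrow> diamond \<Rightarrow> bool" where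
  "banned n D D' \<longleftrightarrow>
     (\<exists>i j. 1 \<le> i \<and> i < j \<and> j \<le> n \<and>
        (NE D = Zero \<and> SW D' = Zero \<and> NW D = Ind i \<and> SE D' = Ind j \<or>
         NE D = Plus \<and> SW D' = Plus \<and> NW D = IndP i \<and> SE D' = IndP j))"

text \<open>In the following, the sequences of length \<open>m\<close> are lists, so that position \<open>i\<close> of a list
  (counted from \<open>0\<close>) holds the item with index \<open>i + 1\<close>. The definitions are meant for \<open>m \<ge> 1\<close>.\<close>

definition left_tilings ::
  "nat \<Rightarrow> (nat \<Rightarrow> nat) \<Rightarrow> nat \<Rightarrow> label list \<Rightarrow> label \<Rightarrow> label \<Rightarrow> label list \<Rightarrow> label \<Rightarrow> label
     \<Rightarrow> (ltile \<times> rtile list \<times> diamond list) set" where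
  "left_tilings n \<sigma> m q r s t u v =
     {(P, Q, D).
        P \<in> ltiles n \<and>
        length Q = m \<and> set Q \<subseteq> rtiles n \<sigma> \<and>
        length D = m \<and> set D \<subseteq> diamonds n \<sigma> \<and>
        lleft P = r \<and> lbottom P = s \<and>
        ltop P = rbottom (Q ! 0) \<and> lright P = SW (D ! 0) \<and>
        (\<forall>i<m. rleft (Q ! i) = q ! i \<and> rright (Q ! i) = NW (D ! i) \<and> SE (D ! i) = t ! i) \<and>
        (\<forall>i. Suc i < m \<longrightarrow>
           rtop (Q ! i) = rbottom (Q ! Suc i) \<and> NE (D ! i) = SW (D ! Suc i) \<and>
           \<not> banned n (D ! i) (D ! Suc i)) \<and>
        rtop (Q ! (m - 1)) = v \<and> NE (D ! (m - 1)) = u}"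

definition right_tilings ::
  "nat \<Rightarrow> (nat \<Rightarrow> nat) \<Rightarrow> nat \<Rightarrow> label list \<Rightarrow> label \<Rightarrow> label \<Rightarrow> label list \<Rightarrow> label \<Rightarrow> label
     \<Rightarrow> (ltile \<times> rtile list \<times> diamond list) set" where
  "right_tilings n \<sigma> m q r s t u v =
     {(P, Q, D).
        P \<in> ltiles n \<and>
        length Q = m \<and> set Q \<subseteq> rtiles n \<sigma> \<and>
        length D = m \<and> set D \<subseteq> diamonds n \<sigma> \<and>
        SW (D ! 0) = r \<and> rbottom (Q ! 0) = s \<and>
        (\<forall>i<m. NW (D ! i) = q ! i \<and> SE (D ! i) = rleft (Q ! i) \<and> rright (Q ! i) = t ! i) \<and>
        (\<forall>i. Suc i < m \<longrightarrow>
           NE (D ! i) = SW (D ! Suc i) \<and> rtop (Q ! i) = rbottom (Q ! Suc i) \<and>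
           \<not> banned n (D ! i) (D ! Suc i)) \<and>
        NE (D ! (m - 1)) = lleft P \<and> rtop (Q ! (m - 1)) = lbottom P \<and>
        ltop P = v \<and> lright P = u}"

text \<open>Diamonds have weight 1, so they do not contribute to the weight of a tiling.\<close>

definition tiling_weight :: "ltile \<times> rtile list \<times> diamond list \<Rightarrow> int poly" where
  "tiling_weight = (\<lambda>(P, Q, D). lweight P * prod_list (map rweight Q))"

definition left_partition ::
  "nat \<Rightarrow> (nat \<Rightarrow> nat) \<Rightarrow> nat \<Rightarrow> label list \<Rightarrow> label \<Rightarrow> label \<Rightarrow> label list \<Rightarrow> label \<Rightarrow> label
     \<Rightarrow> int poly" where
  "left_partition n \<sigma> m q r s t u v = (\<Sum>T\<in>left_tilings n \<sigma> m q r s t u v. tiling_weight T)"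

definition right_partition ::
  "nat \<Rightarrow> (nat \<Rightarrow> nat) \<Rightarrow> nat \<Rightarrow> label list \<Rightarrow> label \<Rightarrow> label \<Rightarrow> label list \<Rightarrow> label \<Rightarrow> label
     \<Rightarrow> int poly" where
  "right_partition n \<sigma> m q r s t u v = (\<Sum>T\<in>right_tilings n \<sigma> m q r s t u v. tiling_weight T)"

text \<open>The sums above range over finite sets, hence are not subject to the convention that a sum over
  an infinite set is zero.\<close>

lemma finite_labels: "finite (labels n \<sigma>)"
proof -
  have "labels n \<sigma> \<subseteq> {Zero, Plus} \<union> Ind ` {1..n} \<union> IndP ` {1..n}
      \<union> (\<lambda>(f, g). Two f g) ` ({1..n} \<times> {1..n}) \<union> (\<lambda>(f, g). TwoP f g) ` ({1..n} \<times> {1..n})"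
    by (auto elim!: labels.cases)
  then show ?thesis
    by (rule finite_subset) simp
qed

lemma finite_rtiles: "finite (rtiles n \<sigma>)"
proof -
  let ?L = "labels n \<sigma>"
  have "rtiles n \<sigma> \<subseteq> (\<lambda>(a, b, c, d). RTile a b c d) ` (?L \<times> ?L \<times> ?L \<times> ?L)"
    by (auto elim!: rtiles.cases simp: image_iff labels.intros)
  then show ?thesis
    by (rule finite_subset) (simp add: finite_labels)
qed

lemma finite_ltiles: "finite (ltiles n)"
proof -
  let ?L = "labels n id"
  have "ltiles n \<subseteq> (\<lambda>(a, b, c, d). LTile a b c d) ` (?L \<times> ?L \<times> ?L \<times> ?L)"
    by (auto elim!: ltiles.cases simp: image_iff labels.intros)
  then show ?thesis
    by (rule finite_subset) (simp add: finite_labels)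
qed

lemma finite_diamonds: "finite (diamonds n \<sigma>)"
proof -
  let ?L = "labels n \<sigma>"
  have "upper2 n \<subseteq> ?L \<times> ?L" "lower2 n \<subseteq> ?L \<times> ?L"
    by (auto simp: upper2_def lower2_def labels.intros)
  moreover have "upper3 n \<sigma> f \<subseteq> ?L \<times> ?L" "lower3 n \<sigma> f \<subseteq> ?L \<times> ?L" if "f \<in> {1..n}" for f
    using that by (auto simp: upper3_def lower3_def labels.intros)
  ultimately have "diamonds n \<sigma> \<subseteq> (\<lambda>(a, b, c, d). Diamond a b c d) ` (?L \<times> ?L \<times> ?L \<times> ?L)"
    by (fastforce elim!: diamonds.cases simp: image_iff labels.intros)
  then show ?thesis
    by (rule finite_subset) (simp add: finite_labels)
qed

lemma finite_tilings:
  "finite (left_tilings n \<sigma> m q r s t u v)" "finite (right_tilings n \<sigma> m q r s t u v)"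
proof -
  let ?F = "ltiles n \<times> {Q. set Q \<subseteq> rtiles n \<sigma> \<and> length Q = m}
    \<times> {D. set D \<subseteq> diamonds n \<sigma> \<and> length D = m}"
  have F: "finite ?F"
    by (simp add: finite_ltiles finite_rtiles finite_diamonds finite_lists_length_eq)
  show "finite (left_tilings n \<sigma> m q r s t u v)"
    by (rule finite_subset[OF _ F]) (auto simp: left_tilings_def)
  show "finite (right_tilings n \<sigma> m q r s t u v)"
    by (rule finite_subset[OF _ F]) (auto simp: right_tilings_def)
qed

end

theory Submission
  imports Defs
begin

text \<open>Read a column from bottom to top as a finite automaton over the letters \<open>(q\<^sub>i, t\<^sub>i)\<close>. Its state is
  the label \<open>c\<close> carried by the right-sheared tiles, the label \<open>d\<close> carried by the diamonds, and, as a
  memory for the banned adjacencies, the largest index \<open>j\<close> that may occur at the next SE edge. Let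
  \<open>F c d j\<close> and \<open>G c d j\<close> be the total weights of the completions of a left and of a right column from
  such a state. The lemma says that \<open>G\<close> is obtained from \<open>F\<close> by the left-sheared tile when \<open>d\<close> is \<open>0\<close>
  or \<open>+\<close>. It is proved by induction on the number of remaining letters, for all states at once, which
  requires to extend the action of the left-sheared tile to the diamond labels \<open>i\<^sup>+\<close>, \<open>fg\<close> and \<open>fg\<^sup>+\<close>.
  The induction step uses linear relations between the values of \<open>F\<close>, and for pairs \<open>c < f\<close> that are inverted by \<open>\<sigma>\<close> only certain sums of two values of \<open>G\<close> are determined.\<close>

section \<open>Plain and plussed labels\<close>

text \<open>A Boolean selects the plain or the plussed version, so facts about tiles that exist in
  both versions are proved once.\<close>

definition base :: "bool \<Rightarrow> label" where
  "base p = (if p then Plus else Zero)"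

definition one :: "bool \<Rightarrow> nat \<Rightarrow> label" where
  "one p i = (if p then IndP i else Ind i)"

definition two :: "bool \<Rightarrow> nat \<Rightarrow> nat \<Rightarrow> label" where
  "two p f g = (if p then TwoP f g else Two f g)"

lemma shade_simps [simp]:
  "base False = Zero" "base True = Plus" "one False = Ind" "one True = IndP"
  "two False = Two" "two True = TwoP"
  by (simp_all add: base_def one_def two_def fun_eq_iff)

lemma shade_eq [simp]:
  "one p i = one q j \<longleftrightarrow> p = q \<and> i = j" "base p = base q \<longleftrightarrow> p = q"
  "one p i \<noteq> base q" "two p f g \<noteq> one q i" "two p f g \<noteq> base q"
  "base q \<noteq> one p i" "one q i \<noteq> two p f g" "base q \<noteq> two p f g"
  by (simp_all add: base_def one_def two_def)

lemma labels_shade_cases: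
  assumes "a \<in> labels n \<sigma>"
  obtains p where "a = base p" | p i where "a = one p i" "i \<in> {1..n}"
    | p f g where "a = two p f g" "f \<in> {1..n}" "g \<in> {1..n}" "\<sigma> f < \<sigma> g"
  using assms
proof cases
  case 1 then show ?thesis using that(1)[of False] by simp next
  case 2 then show ?thesis using that(1)[of True] by simp next
  case (3 i) then show ?thesis using that(2)[of False] by simp next
  case (4 i) then show ?thesis using that(2)[of True] by simp next
  case (5 f g) then show ?thesis using that(3)[of False] by simp next
  case (6 f g) then show ?thesis using that(3)[of True] by simp
qed

text \<open>The banned adjacencies, as a bound that a diamond imposes on the next SE index; the bound \<open>n\<close>
  is no restriction.\<close>

definition limit :: "nat \<Rightarrow> diamond \<Rightarrow> nat" where
  "limit n D = (case (NE D, NW D) of (Zero, Ind i) \<Rightarrow> i | (Plus, IndP i) \<Rightarrow> i | _ \<Rightarrow> n)"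

definition blocked :: "nat \<Rightarrow> label \<Rightarrow> label \<Rightarrow> bool" where
  "blocked j d e \<longleftrightarrow> (\<exists>p h. d = base p \<and> e = one p h \<and> j < h)"

lemma blocked_simps [simp]:
  "blocked j (base p) (one q h) \<longleftrightarrow> p = q \<and> j < h"
  "\<not> blocked j (one p k) e" "\<not> blocked j (two p f g) e" "\<not> blocked j d (base p)"
  "\<not> blocked j d (two p f g)"
  by (auto simp: blocked_def)

locale column =
  fixes n :: nat and \<sigma> :: "nat \<Rightarrow> nat"
  assumes perm: "\<sigma> permutes {1..n}"
begin

section \<open>Sums over the tiles at one position\<close>

lemma sigma_eq [simp]: "\<sigma> i = \<sigma> j \<longleftrightarrow> i = j"
  using permutes_inj[OF perm] by (simp add: inj_eq)

text \<open>Going up a left column, the left and bottom edges of the right-sheared tile are known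
  (\<open>rsum\<close>); in a right column it is the right and bottom edges
  (\<open>lsum\<close>).\<close>

definition rsum :: "label \<Rightarrow> label \<Rightarrow> (label \<Rightarrow> label \<Rightarrow> int poly) \<Rightarrow> int poly" where
  "rsum a c K = (\<Sum>Q | Q \<in> rtiles n \<sigma> \<and> rleft Q = a \<and> rbottom Q = c. rweight Q * K (rtop Q) (rright Q))"

definition lsum :: "label \<Rightarrow> label \<Rightarrow> (label \<Rightarrow> label \<Rightarrow> int poly) \<Rightarrow> int poly" where
  "lsum b c K = (\<Sum>Q | Q \<in> rtiles n \<sigma> \<and> rright Q = b \<and> rbottom Q = c. rweight Q * K (rleft Q) (rtop Q))"

definition dsum :: "label \<Rightarrow> nat \<Rightarrow> label \<Rightarrow> label \<Rightarrow> (label \<Rightarrow> nat \<Rightarrow> int poly) \<Rightarrow> int poly" where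
  "dsum d j a e K = (if blocked j d e then 0 else
     (\<Sum>D | D \<in> diamonds n \<sigma> \<and> NW D = a \<and> SW D = d \<and> SE D = e. K (NE D) (limit n D)))"

text \<open>The SW and SE edges determine the family of a diamond, and its NW edge \<open>a\<close> then determines NE:
  \<open>up2\<close> and \<open>up3 f\<close> stand for the families (2) and (3).\<close>

definition up2 :: "label \<Rightarrow> (label \<Rightarrow> nat \<Rightarrow> int poly) \<Rightarrow> int poly" where
  "up2 a K = (case a of Zero \<Rightarrow> K Plus n | Ind i \<Rightarrow> if i \<in> {1..n} then K (IndP i) n else 0 | _ \<Rightarrow> 0)"

definition up3 :: "nat \<Rightarrow> label \<Rightarrow> (label \<Rightarrow> nat \<Rightarrow> int poly) \<Rightarrow> int poly" where
  "up3 f a K = (let hit = (\<lambda>p g. if g = f then K (base p) f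
       else if g \<in> {1..n} \<and> \<sigma> f < \<sigma> g then K (two p f g) n else 0)
     in case a of Ind g \<Rightarrow> hit False g | IndP g \<Rightarrow> hit True g | _ \<Rightarrow> 0)"

lemma up2_simps [simp]:
  "up2 Zero K = K Plus n" "up2 Plus K = 0" "up2 (IndP i) K = 0" "up2 (two p f g) K = 0"
  "up2 (Two f g) K = 0" "up2 (TwoP f g) K = 0"
  by (simp_all add: up2_def two_def)

lemma up2_Ind: "i \<in> {1..n} \<Longrightarrow> up2 (Ind i) K = K (IndP i) n"
  by (simp add: up2_def)

lemma up3_simps [simp]:
  "up3 f (base p) K = 0" "up3 f (two p k l) K = 0"
  "up3 f Zero K = 0" "up3 f Plus K = 0" "up3 f (Two k l) K = 0" "up3 f (TwoP k l) K = 0"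
  by (simp_all add: up3_def two_def base_def)

lemma up3_one:
  "up3 f (one p g) K = (if g = f then K (base p) f
     else if g \<in> {1..n} \<and> \<sigma> f < \<sigma> g then K (two p f g) n else 0)"
  by (simp add: up3_def one_def Let_def)

section \<open>Evaluating the sums over diamonds\<close>

lemma upper3_iff:
  "(a, e) \<in> upper3 n \<sigma> f \<longleftrightarrow> (\<exists>p g. a = one p g \<and>
     (if g = f then e = base p else g \<in> {1..n} \<and> \<sigma> f < \<sigma> g \<and> e = two p f g))"
proof -
  have "(\<exists>p g. a = one p g \<and> (if g = f then e = base p else g \<in> {1..n} \<and> \<sigma> f < \<sigma> g \<and> e = two p f g))
     \<longleftrightarrow> (\<exists>p. a = one p f \<and> e = base p \<or> (\<exists>g. a = one p g \<and> g \<in> {1..n} \<and> \<sigma> f < \<sigma> g \<and> e = two p f g))"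
    by (smt (verit) less_irrefl)
  then show ?thesis
    by (auto simp: upper3_def ex_bool_eq)
qed

lemma lower3_iff:
  "(d, e) \<in> lower3 n \<sigma> f \<longleftrightarrow> (\<exists>p. d = base p \<and> e = one p f
     \<or> (\<exists>h\<in>{1..n}. \<sigma> f < \<sigma> h \<and> d = two p f h \<and> e = one p h))"
  by (auto simp: lower3_def ex_bool_eq)

text \<open>The index \<open>f\<close> can be read off any pair in
  \<open>lower3 n \<sigma> f\<close>, and these pairs avoid \<open>lower2 n\<close> and
  \<open>(Zero, Zero)\<close>, so the lower edges leave a single family.\<close>

lemma diamonds_lower3:
  assumes "f \<in> {1..n}" "(d, e) \<in> lower3 n \<sigma> f"
  shows "Diamond a x d e \<in> diamonds n \<sigma> \<longleftrightarrow> (a, x) \<in> upper3 n \<sigma> f"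
proof
  assume "Diamond a x d e \<in> diamonds n \<sigma>"
  then show "(a, x) \<in> upper3 n \<sigma> f"
  proof cases
    case (3 g)
    then have "g = f" using assms by (auto simp: lower3_def)
    then show ?thesis using 3 by simp
  qed (use assms in \<open>auto simp: lower3_def lower2_def\<close>)
qed (use assms in \<open>auto intro: diamonds.intros\<close>)

lemma diamonds_lower2:
  assumes "(d, e) \<in> lower2 n"
  shows "Diamond a x d e \<in> diamonds n \<sigma> \<longleftrightarrow> (a, x) \<in> upper2 n"
  using assms by (auto simp: diamonds.simps lower2_def lower3_def)

lemma diamonds_none:
  assumes "(d, e) \<noteq> (Zero, Zero)" "(d, e) \<notin> lower2 n" "\<And>f. f \<in> {1..n} \<Longrightarrow> (d, e) \<notin> lower3 n \<sigma> f"
  shows "Diamond a x d e \<notin> diamonds n \<sigma>"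
  using assms by (auto simp: diamonds.simps)

lemma dsum_eq:
  "dsum d j a e K = (if blocked j d e then 0 else
     (\<Sum>x | Diamond a x d e \<in> diamonds n \<sigma>. K x (limit n (Diamond a x d e))))"
proof -
  have "{D \<in> diamonds n \<sigma>. NW D = a \<and> SW D = d \<and> SE D = e}
      = (\<lambda>x. Diamond a x d e) ` {x. Diamond a x d e \<in> diamonds n \<sigma>}"
    by (auto simp: image_iff) (metis diamond.collapse)
  then show ?thesis
    by (auto simp: dsum_def sum.reindex inj_on_def)
qed

lemma dsum_lower3:
  assumes "f \<in> {1..n}" "(d, e) \<in> lower3 n \<sigma> f"
  shows "dsum d j a e K = (if blocked j d e then 0 else up3 f a K)"
proof -
  have "{x. Diamond a x d e \<in> diamonds n \<sigma>} = {x. (a, x) \<in> upper3 n \<sigma> f}"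
    using diamonds_lower3[OF assms] by simp
  moreover have "(\<Sum>x | (a, x) \<in> upper3 n \<sigma> f. K x (limit n (Diamond a x d e))) = up3 f a K"
  proof (cases "\<exists>p g. a = one p g")
    case True
    then obtain p g where "a = one p g" by blast
    moreover have "limit n (Diamond (one p g) (base p) d e) = g"
      "limit n (Diamond (one p g) (two p f g) d e) = n"
      by (cases p; simp add: limit_def)+
    ultimately show ?thesis
      by (auto simp: upper3_iff up3_one)
  next
    case False
    then have "{x. (a, x) \<in> upper3 n \<sigma> f} = {}"
      by (auto simp: upper3_iff)
    moreover have "up3 f a K = 0"
      using False by (cases a) (auto simp: up3_def ex_bool_eq)
    ultimately show ?thesis by simp
  qed
  ultimately show ?thesis
    by (simp add: dsum_eq)
qed

lemma dsum_lower2: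
  assumes "(d, e) \<in> lower2 n"
  shows "dsum d j a e K = up2 a K"
proof -
  have "{x. Diamond a x d e \<in> diamonds n \<sigma>} = {x. (a, x) \<in> upper2 n}"
    using diamonds_lower2[OF assms] by simp
  moreover have "\<not> blocked j d e"
    using assms by (auto simp: lower2_def blocked_def base_def one_def split: if_splits)
  moreover have "{x. (a, x) \<in> upper2 n} = (case a of Zero \<Rightarrow> {Plus} | Ind i \<Rightarrow> if i \<in> {1..n} then {IndP i} else {} | _ \<Rightarrow> {})"
    by (auto simp: upper2_def split: label.splits)
  ultimately show ?thesis
    by (auto simp: dsum_eq up2_def limit_def split: label.splits)
qed

lemma dsum_none:
  assumes "(d, e) \<noteq> (Zero, Zero)" "(d, e) \<notin> lower2 n" "\<And>f. f \<in> {1..n} \<Longrightarrow> (d, e) \<notin> lower3 n \<sigma> f"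
  shows "dsum d j a e K = 0"
  using diamonds_none[OF assms] by (simp add: dsum_eq)

lemma dsum_base_one:
  assumes "h \<in> {1..n}"
  shows "dsum (base p) j a (one q h) K = (if q = p \<and> h \<le> j then up3 h a K else 0)"
proof (cases "q = p")
  case True
  have "dsum (base p) j a (one p h) K = (if blocked j (base p) (one p h) then 0 else up3 h a K)"
    by (rule dsum_lower3) (use assms in \<open>auto simp: lower3_iff\<close>)
  then show ?thesis using True by auto
next
  case False
  have "dsum (base p) j a (one q h) K = 0"
    by (rule dsum_none) (use False in \<open>cases p; cases q; auto simp: lower2_def lower3_def\<close>)+
  then show ?thesis using False by simp
qed

lemma dsum_two_other:
  "e \<noteq> one p h \<Longrightarrow> dsum (two p f h) j a e K = 0"
  by (rule dsum_none; cases p; auto simp: lower2_def lower3_def)+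

lemma dsum_two:
  assumes "f \<in> {1..n}" "h \<in> {1..n}" "\<sigma> f < \<sigma> h"
  shows "dsum (two p f h) j a e K = (if e = one p h then up3 f a K else 0)"
proof (cases "e = one p h")
  case True
  have "dsum (two p f h) j a (one p h) K
      = (if blocked j (two p f h) (one p h) then 0 else up3 f a K)"
    by (rule dsum_lower3) (use assms in \<open>auto simp: lower3_iff\<close>)
  then show ?thesis using True by simp
qed (simp add: dsum_two_other)

lemma dsum_base_two: "dsum (base p) j a (two q k l) K = 0"
  by (rule dsum_none; cases p; cases q; auto simp: lower2_def lower3_def)+

lemma dsum_Zero_Zero: "dsum Zero j a Zero K = (if a = Zero then K Zero n else 0)"
proof -
  have "{x. Diamond a x Zero Zero \<in> diamonds n \<sigma>} = (if a = Zero then {Zero} else {})"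
    by (auto simp: diamonds.simps lower2_def lower3_def)
  then show ?thesis
    by (auto simp: dsum_eq limit_def blocked_def base_def one_def)
qed

lemma dsum_Plus_Zero: "dsum Plus j a Zero K = up2 a K"
  by (rule dsum_lower2) (simp add: lower2_def)

lemma dsum_base_Plus: "dsum (base p) j a Plus K = 0"
  by (rule dsum_none; cases p; auto simp: lower2_def lower3_def)+

lemma dsum_IndP:
  assumes "k \<in> {1..n}"
  shows "dsum (IndP k) j a e K = (if e = Ind k then up2 a K else 0)"
proof (cases "e = Ind k")
  case True
  then show ?thesis using assms by (auto simp: lower2_def intro: dsum_lower2)
next
  case False
  have "dsum (IndP k) j a e K = 0"
    by (rule dsum_none) (use False in \<open>auto simp: lower2_def lower3_def\<close>)+
  then show ?thesis using False by simp
qed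

lemmas dsum_simps =
  dsum_Zero_Zero dsum_Plus_Zero dsum_IndP
  dsum_base_Plus[of False, simplified] dsum_base_Plus[of True, simplified]
  dsum_base_one[of _ False _ _ False, simplified] dsum_base_one[of _ False _ _ True, simplified]
  dsum_base_one[of _ True _ _ False, simplified] dsum_base_one[of _ True _ _ True, simplified]
  dsum_base_two[of False _ _ False, simplified] dsum_base_two[of False _ _ True, simplified]
  dsum_base_two[of True _ _ False, simplified] dsum_base_two[of True _ _ True, simplified]
  dsum_two[of _ _ False, unfolded shade_simps] dsum_two[of _ _ True, unfolded shade_simps]

section \<open>Evaluating the sums over right-sheared tiles\<close>

lemmas rtiles_iff = rtiles.simps[of "RTile l t b r" n \<sigma> for l t b r, unfolded rtile.inject]

lemma rsum_eq:
  "rsum a c K = (\<Sum>(t, r) | RTile a t c r \<in> rtiles n \<sigma>. rweight (RTile a t c r) * K t r)"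
proof -
  have "{Q \<in> rtiles n \<sigma>. rleft Q = a \<and> rbottom Q = c}
      = (\<lambda>(t, r). RTile a t c r) ` {(t, r). RTile a t c r \<in> rtiles n \<sigma>}"
    by (auto simp: image_iff) (metis rtile.collapse)
  then show ?thesis
    by (auto simp: rsum_def sum.reindex inj_on_def case_prod_unfold)
qed

lemma lsum_eq:
  "lsum b c K = (\<Sum>(l, t) | RTile l t c b \<in> rtiles n \<sigma>. rweight (RTile l t c b) * K l t)"
proof -
  have "{Q \<in> rtiles n \<sigma>. rright Q = b \<and> rbottom Q = c}
      = (\<lambda>(l, t). RTile l t c b) ` {(l, t). RTile l t c b \<in> rtiles n \<sigma>}"
    by (auto simp: image_iff) (metis rtile.collapse)
  then show ?thesis
    by (auto simp: lsum_def sum.reindex inj_on_def case_prod_unfold)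
qed

lemma rweight_one [simp]: "rweight (RTile (one p i) t b r) = 1"
  "rweight (RTile l t b (one p i)) = 1" "rweight (RTile l t Zero r) = 1"
   "rweight (RTile l t Plus r) = 1" "rweight (RTile Zero (Ind i) (Ind i) Zero) = x_c"
  by (auto simp: rweight_def one_def)

lemma rsum_Zero_Zero: "rsum Zero Zero K = K Zero Zero + (\<Sum>i\<in>{1..n}. K (Ind i) (Ind i))"
proof -
  have *: "{(t, r). RTile Zero t Zero r \<in> rtiles n \<sigma>} = insert (Zero, Zero) ((\<lambda>i. (Ind i, Ind i)) ` {1..n})"
    by (auto simp: rtiles_iff one_def base_def)
  then show ?thesis
    unfolding rsum_eq * by (subst sum.insert; auto simp: sum.reindex inj_on_def)
qed

lemma rsum_Zero_Plus: "rsum Zero Plus K = K Plus Zero + (\<Sum>i\<in>{1..n}. K (Ind i) (IndP i))"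
proof -
  have *: "{(t, r). RTile Zero t Plus r \<in> rtiles n \<sigma>} = insert (Plus, Zero) ((\<lambda>i. (Ind i, IndP i)) ` {1..n})"
    by (auto simp: rtiles_iff one_def base_def)
  then show ?thesis
    unfolding rsum_eq * by (subst sum.insert; auto simp: sum.reindex inj_on_def)
qed

lemma rsum_Zero_Ind:
  assumes "i \<in> {1..n}"
  shows "rsum Zero (Ind i) K = x_c * K (Ind i) Zero"
proof -
  have *: "{(t, r). RTile Zero t (Ind i) r \<in> rtiles n \<sigma>} = {(Ind i, Zero)}"
    using assms by (auto simp: rtiles_iff)
  show ?thesis
    unfolding rsum_eq * by simp
qed

lemma rsum_one_Ind:
  assumes "i \<in> {1..n}" "j \<in> {1..n}"
  shows "rsum (one p j) (Ind i) K
    = (if j = i then K (base p) Zero + (\<Sum>k\<in>{1..i}. K (Ind k) (one p k))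
       else if \<sigma> i < \<sigma> j then K (Ind i) (one p j) else 0)"
proof -
  have *: "{(t, r). RTile (one p j) t (Ind i) r \<in> rtiles n \<sigma>}
     = (if j = i then insert (base p, Zero) ((\<lambda>k. (Ind k, one p k)) ` {1..i})
        else if \<sigma> i < \<sigma> j then {(Ind i, one p j)} else {})"
    using assms by (cases p) (auto simp: rtiles_iff)
  have "(base p, Zero) \<notin> (\<lambda>k. (Ind k, one p k)) ` {1..i}"
    by (auto simp: base_def)
  then show ?thesis
    unfolding rsum_eq * by (simp add: sum.reindex inj_on_def)
qed

lemma rsum_Ind_Plus:
  assumes "i \<in> {1..n}"
  shows "rsum (Ind i) Plus K = K Plus (Ind i)"
proof -
  have *: "{(t, r). RTile (Ind i) t Plus r \<in> rtiles n \<sigma>} = {(Plus, Ind i)}"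
    using assms by (auto simp: rtiles_iff)
  show ?thesis
    unfolding rsum_eq * by simp
qed

lemma rsum_0:
  assumes "\<And>t r. RTile a t c r \<notin> rtiles n \<sigma>"
  shows "rsum a c K = 0"
  using assms by (simp add: rsum_eq)

lemma rsum_none:
  "rsum (one p i) Zero K = 0" "rsum (IndP i) Plus K = 0" "rsum Plus c K = 0"
  "rsum (two p f g) c K = 0" "rsum a (IndP i) K = 0" "rsum a (two p f g) K = 0"
  by (rule rsum_0; simp add: rtiles_iff one_def two_def)+

lemma lsum_0:
  assumes "\<And>l t. RTile l t c b \<notin> rtiles n \<sigma>"
  shows "lsum b c K = 0"
  using assms by (simp add: lsum_eq)

lemma lsum_Zero_base: "lsum Zero (base p) K = K Zero (base p)"
proof -
  have *: "{(l, t). RTile l t (base p) Zero \<in> rtiles n \<sigma>} = {(Zero, base p)}"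
    by (cases p) (auto simp: rtiles_iff)
  show ?thesis
    unfolding lsum_eq * by (cases p) simp_all
qed

lemma lsum_Zero_Ind:
  assumes "i \<in> {1..n}"
  shows "lsum Zero (Ind i) K = K (Ind i) Zero + K (IndP i) Plus + x_c * K Zero (Ind i)"
proof -
  have *: "{(l, t). RTile l t (Ind i) Zero \<in> rtiles n \<sigma>} = {(Ind i, Zero), (IndP i, Plus), (Zero, Ind i)}"
    using assms by (auto simp: rtiles_iff)
  show ?thesis
    unfolding lsum_eq * using rweight_one(1)[of False] rweight_one(1)[of True]
    by (simp add: algebra_simps)
qed

lemma lsum_one_base:
  assumes "k \<in> {1..n}"
  shows "lsum (one q k) (base p) K
    = (if p = q then K Zero (Ind k) else if p then K (Ind k) Plus else 0)"
proof -
  have *: "{(l, t). RTile l t (base p) (one q k) \<in> rtiles n \<sigma>}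
    = (if p = q then {(Zero, Ind k)} else if p then {(Ind k, Plus)} else {})"
    using assms by (cases p; cases q) (auto simp: rtiles_iff)
  show ?thesis
    unfolding lsum_eq * by simp
qed

text \<open>Two tiles fit exactly when \<open>k < i\<close> and
  \<open>\<sigma> i < \<sigma> k\<close>. This is why a right column reaches certain states only in
  pairs.\<close>

lemma lsum_one_Ind:
  assumes "k \<in> {1..n}" "i \<in> {1..n}"
  shows "lsum (one p k) (Ind i) K = (if k \<le> i then K (one p i) (Ind k) else 0)
    + (if \<sigma> i < \<sigma> k then K (one p k) (Ind i) else 0)"
proof -
  have *: "{(l, t). RTile l t (Ind i) (one p k) \<in> rtiles n \<sigma>}
    = (if k \<le> i then {(one p i, Ind k)} else {}) \<union> (if \<sigma> i < \<sigma> k then {(one p k, Ind i)} else {})"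
    using assms by (cases p) (auto simp: rtiles_iff)
  show ?thesis
    unfolding lsum_eq * by (subst sum.union_disjoint) (auto split: if_splits)
qed

lemma lsum_none:
  "lsum Plus c K = 0" "lsum (two p f g) c K = 0" "lsum b (IndP i) K = 0" "lsum b (two p f g) K = 0"
  by (rule lsum_0; simp add: rtiles_iff one_def two_def)+

lemmas lsum_simps = lsum_Zero_Ind lsum_none
  lsum_none(2)[of False, simplified] lsum_none(2)[of True, simplified]
  lsum_Zero_base[of False, simplified] lsum_Zero_base[of True, simplified]
  lsum_one_base[of _ False False, simplified] lsum_one_base[of _ False True, simplified]
  lsum_one_base[of _ True False, simplified] lsum_one_base[of _ True True, simplified]
  lsum_one_Ind[of _ _ False, simplified] lsum_one_Ind[of _ _ True, simplified]

section \<open>Relations between the completions of a left column\<close>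

text \<open>\<open>lstep F a b\<close> and \<open>rstep G a b\<close> prepend a row with outer labels \<open>q = a\<close> and \<open>t = b\<close>.\<close>

definition lstep ::
  "(label \<Rightarrow> label \<Rightarrow> nat \<Rightarrow> int poly) \<Rightarrow> label \<Rightarrow> label \<Rightarrow> label \<Rightarrow> label \<Rightarrow> nat \<Rightarrow> int poly" where
  "lstep F a b c d j = rsum a c (\<lambda>t r. dsum d j r b (F t))"

definition rstep ::
  "(label \<Rightarrow> label \<Rightarrow> nat \<Rightarrow> int poly) \<Rightarrow> label \<Rightarrow> label \<Rightarrow> label \<Rightarrow> label \<Rightarrow> nat \<Rightarrow> int poly" where
  "rstep G a b c d j = lsum b c (\<lambda>l t. dsum d j a l (G t))"

text \<open>The value of one left row when \<open>c\<close> is carried and the SW and SE edges put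
  the diamond into family (3) with index \<open>f\<close>.\<close>

definition left3 ::
  "(label \<Rightarrow> label \<Rightarrow> nat \<Rightarrow> int poly) \<Rightarrow> nat \<Rightarrow> nat \<Rightarrow> label \<Rightarrow> int poly" where
  "left3 F f c a = rsum a (Ind c) (\<lambda>t r. up3 f r (F t))"

text \<open>First relation: for a fixed next SE index \<open>h\<close>, carried index and family
  index may be exchanged, up to a condition on \<sigma>. Second: raising the bound from
  \<open>c\<close> to \<open>f\<close> admits SE indices \<open>h\<close> in \<open>{c<..f}\<close>,
  and those with \<open>\<sigma> c < \<sigma> h\<close> contribute as much as the state
  \<open>(h, ch)\<close>.\<close>

definition left_relations :: "(label \<Rightarrow> label \<Rightarrow> nat \<Rightarrow> int poly) \<Rightarrow> bool" where
  "left_relations F \<longleftrightarrow> (\<forall>p. \<forall>c\<in>{1..n}. \<forall>f\<in>{1..n}. c < f \<longrightarrow>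
     (\<forall>h\<in>{1..n}. \<sigma> f < \<sigma> h \<longrightarrow>
        F (Ind c) (two p f h) n = (if \<sigma> c < \<sigma> f then F (Ind f) (two p c h) n else 0)) \<and>
     F (Ind c) (base p) f = F (Ind c) (base p) c
       + (\<Sum>h | h \<in> {c<..f} \<and> \<sigma> c < \<sigma> h. F (Ind h) (two p c h) n))"

lemma sum_split_at:
  fixes f :: "nat \<Rightarrow> 'a::comm_monoid_add"
  assumes "1 \<le> i" "i \<le> h"
  shows "sum f {1..h} = sum f {1..<i} + f i + sum f {i<..h}"
proof -
  have "{1..h} = {1..i} \<union> {i<..h}" using assms by auto
  then have "sum f {1..h} = sum f {1..i} + sum f {i<..h}"
    by (simp add: sum.union_disjoint ivl_disj_int)
  moreover have "{1..i} = insert i {1..<i}" using assms by auto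
  then have "sum f {1..i} = sum f {1..<i} + f i"
    by (simp add: add.commute)
  ultimately show ?thesis by simp
qed

lemma left3_one:
  assumes "f \<in> {1..n}" "c \<in> {1..n}" "g \<in> {1..n}"
  shows "left3 F f c (one p g) = (if g = c then \<Sum>k\<in>{1..c}. up3 f (one p k) (F (Ind k))
    else if \<sigma> c < \<sigma> g then up3 f (one p g) (F (Ind c)) else 0)"
  using assms by (simp add: left3_def rsum_one_Ind)

lemma left3_other:
  assumes "c \<in> {1..n}"
  shows "left3 F f c (two p k l) = 0" "left3 F f c (base p) = 0"
  subgoal by (simp add: left3_def rsum_none)
  subgoal using assms by (cases p) (simp_all add: left3_def rsum_Zero_Ind rsum_none)
  done

lemma left_relations_two:
  assumes "left_relations F" "c \<in> {1..n}" "f \<in> {1..n}" "h \<in> {1..n}" "c < f" "\<sigma> f < \<sigma> h"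
  shows "F (Ind c) (two p f h) n = (if \<sigma> c < \<sigma> f then F (Ind f) (two p c h) n else 0)"
  using assms unfolding left_relations_def by blast

text \<open>A summand not trivially 0 is a value of \<open>F\<close> at \<open>(k, fk)\<close> with
  \<open>k < f\<close> and \<open>\<sigma> f < \<sigma> k\<close>, and the first relation makes
  \<open>F\<close> vanish at such an inversion.\<close>

lemma sum_up3_below:
  assumes "left_relations F" "f \<in> {1..n}" "c < f"
  shows "(\<Sum>k\<in>{1..c}. up3 f (one p k) (F (Ind k))) = 0"
  using assms by (intro sum.neutral) (auto simp: left_relations_two[OF assms(1)] up3_one)

text \<open>Terms below \<open>f\<close> vanish as before, the term at \<open>f\<close> is the value
  with bound \<open>f\<close>, and the terms above \<open>f\<close> are the increment that the
  second relation gives when the bound rises from \<open>f\<close> to \<open>j\<close>.\<close>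

lemma sum_up3:
  assumes F: "left_relations F" and f: "f \<in> {1..n}" "f \<le> j" "j \<le> n"
  shows "(\<Sum>k\<in>{1..j}. up3 f (one p k) (F (Ind k))) = F (Ind f) (base p) j"
proof -
  have "(\<Sum>k\<in>{1..j}. up3 f (one p k) (F (Ind k)))
      = (\<Sum>k\<in>{1..<f}. up3 f (one p k) (F (Ind k))) + up3 f (one p f) (F (Ind f))
        + (\<Sum>k\<in>{f<..j}. up3 f (one p k) (F (Ind k)))"
    using f by (intro sum_split_at) auto
  also have "(\<Sum>k\<in>{1..<f}. up3 f (one p k) (F (Ind k))) = 0"
    using f by (intro sum.neutral) (auto simp: left_relations_two[OF F] up3_one)
  also have "(\<Sum>k\<in>{f<..j}. up3 f (one p k) (F (Ind k)))
      = (\<Sum>k | k \<in> {f<..j} \<and> \<sigma> f < \<sigma> k. F (Ind k) (two p f k) n)"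
    using f by (intro sum.mono_neutral_cong_right) (auto simp: up3_one)
  finally show ?thesis
    using F f by (cases "f = j") (auto simp: left_relations_def up3_one)
qed

text \<open>The inductive core of all the relations: when the next SE edge selects the family, exchanging
  the carried index with the family index only matters through \<open>\<sigma>\<close>.\<close>

lemma left3_swap:
  assumes F: "left_relations F" and a: "a \<in> labels n \<sigma>" and ih: "i \<in> {1..n}" "h \<in> {1..n}" "i < h"
  shows "left3 F h i a = (if \<sigma> i < \<sigma> h then left3 F i h a else 0)"
  using a
proof (cases rule: labels_shade_cases)
  case (2 p g)
  \<comment> \<open>For \<open>g = i\<close> both sides vanish; for \<open>g = h\<close> both are
    \<open>F (Ind i) (base p) h\<close> if \<open>\<sigma> i < \<sigma> h\<close>, and 0 otherwise;
    for any other \<open>g\<close> this is the first relation.\<close>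
  then show ?thesis
    using ih sum_up3[OF F, of i h p] sum_up3_below[OF F, of h i p]
    by (auto simp: left3_one left_relations_two[OF F] up3_one)
qed (use ih in \<open>simp_all add: left3_other\<close>)

lemma rsum_zero [simp]: "rsum a c (\<lambda>t r. 0) = 0"
  by (simp add: rsum_def)

lemma lstep_one:
  assumes "k \<in> {1..n}"
  shows "lstep F a (one q k) (Ind c) (base p) j = (if q = p \<and> k \<le> j then left3 F k c a else 0)"
    "f \<in> {1..n} \<Longrightarrow> h \<in> {1..n} \<Longrightarrow> \<sigma> f < \<sigma> h \<Longrightarrow>
      lstep F a (one q k) (Ind c) (two p f h) j = (if q = p \<and> k = h then left3 F f c a else 0)"
  using assms by (simp_all add: lstep_def left3_def dsum_base_one dsum_two eq_commute[of k])

lemma dsum_base_base: "dsum (base p) j a (base q) K = (if q then 0 else if p then up2 a K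
    else if a = Zero then K Zero n else 0)"
  by (cases p; cases q) (simp_all add: dsum_simps)

lemma lstep_two_other:
  "lstep F a (base q) c (two p f h) j = 0" "lstep F a (two q k l) c (two p f h) j = 0"
  "lstep F a (two q k l) c (base p) j = 0"
  by (simp_all add: lstep_def dsum_two_other dsum_base_two)

lemma lstep_base_base:
  "lstep F a (base q) c (base p) j = lstep F a (base q) c (base p) i"
  by (simp add: lstep_def dsum_base_base)

text \<open>If \<open>b\<close> is \<open>Zero\<close> or \<open>Plus\<close>, the values at
  two-index labels vanish and the bound is irrelevant. If \<open>b\<close> has one index
  \<open>k\<close>, only the summand \<open>h = k\<close> survives and \<open>left3_swap\<close>
  applies. Otherwise all values involved are 0.\<close>

lemma left_relations_lstep:
  assumes F: "left_relations F" and a: "a \<in> labels n \<sigma>" and b: "b \<in> labels n \<sigma>"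
  shows "left_relations (lstep F a b)"
  using b
proof (cases rule: labels_shade_cases)
  case (1 q)
  show ?thesis
    unfolding left_relations_def 1 lstep_two_other
    by (auto intro: lstep_base_base)
next
  case (2 q k)
  show ?thesis
    unfolding left_relations_def
  proof (intro allI ballI impI conjI)
    fix p c f h
    assume "c \<in> {1..n}" "f \<in> {1..n}" "c < f" "h \<in> {1..n}" "\<sigma> f < \<sigma> h"
    then show "lstep F a b (Ind c) (two p f h) n
        = (if \<sigma> c < \<sigma> f then lstep F a b (Ind f) (two p c h) n else 0)"
      using 2 by (simp add: lstep_one left3_swap[OF F a])
  next
    fix p c f
    assume cf: "c \<in> {1..n}" "f \<in> {1..n}" "c < f"
    have "(\<Sum>h | h \<in> {c<..f} \<and> \<sigma> c < \<sigma> h. lstep F a b (Ind h) (two p c h) n)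
        = (\<Sum>h | h \<in> {c<..f} \<and> \<sigma> c < \<sigma> h. if h = k then if q = p then left3 F c k a else 0 else 0)"
      using 2 cf by (intro sum.cong) (auto simp: lstep_one)
    also have "\<dots> = (if k \<in> {c<..f} \<and> \<sigma> c < \<sigma> k \<and> q = p then left3 F c k a else 0)"
      by (subst sum.delta) auto
    \<comment> \<open>\<open>left3_swap\<close> absorbs the condition on \<sigma>; what remains is
      the difference between the bounds \<open>k \<le> f\<close> and
      \<open>k \<le> c\<close>.\<close>
    also have "\<dots> = (if k \<in> {c<..f} \<and> q = p then left3 F k c a else 0)"
      using 2 cf by (auto simp: left3_swap[OF F a])
    finally show "lstep F a b (Ind c) (base p) f = lstep F a b (Ind c) (base p) c
       + (\<Sum>h | h \<in> {c<..f} \<and> \<sigma> c < \<sigma> h. lstep F a b (Ind h) (two p c h) n)"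
      using 2 cf by (auto simp: lstep_one)
  qed
next
  case (3 q k l)
  show ?thesis
    unfolding left_relations_def 3 lstep_two_other by simp
qed

lemmas up3_Ind = up3_one[of _ False, unfolded shade_simps]
lemmas up3_IndP = up3_one[of _ True, unfolded shade_simps]

lemmas rsum_trivial [simp] = rsum_none(2-6) rsum_none(1)[of False, unfolded shade_simps]
  rsum_none(1)[of True, unfolded shade_simps]
  rsum_none(4)[of False, unfolded shade_simps] rsum_none(4)[of True, unfolded shade_simps]

section \<open>Completions of a right column in terms of those of a left column\<close>

text \<open>Subtracting the term with \<open>x_c\<close> accounts for the left-sheared tile of weight \<open>- x_c\<close>. The last
  three conditions cover the states \<open>(c, fh)\<close>: if \<open>c < f\<close> is an inversion of \<open>\<sigma>\<close> and \<open>\<sigma> c \<le> \<sigma> h\<close>, a single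
  value of \<open>G\<close> is not a combination of values of \<open>F\<close>, but a right column reaches \<open>(c, fh)\<close> only together
  with \<open>(f, ch)\<close>, or with \<open>(f, 0)\<close> if \<open>h = c\<close>.\<close>

definition intertwined ::
  "(label \<Rightarrow> label \<Rightarrow> nat \<Rightarrow> int poly) \<Rightarrow> (label \<Rightarrow> label \<Rightarrow> nat \<Rightarrow> int poly) \<Rightarrow> bool" where
  "intertwined F G \<longleftrightarrow>
     (\<forall>j. G Zero Zero j = F Zero Zero n) \<and>
     (\<forall>j\<le>n. G Plus Zero j = F Zero Plus n + (\<Sum>i\<in>{1..j}. F (Ind i) (IndP i) n) - x_c * F Plus Zero j) \<and>
     (\<forall>j. G Zero Plus j = F Plus Zero n) \<and>
     (\<forall>j. G Plus Plus j = F Plus Plus n) \<and>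
     (\<forall>p. \<forall>i\<in>{1..n}. \<forall>j\<in>{i..n}. G (Ind i) (base p) j = F (Ind i) (base p) j) \<and>
     (\<forall>k\<in>{1..n}. G Zero (IndP k) n = 0 \<and> G Plus (IndP k) n = F Plus (IndP k) n \<and>
        (\<forall>i\<in>{1..n}. G (Ind i) (IndP k) n = up3 i (Ind k) (F Plus))) \<and>
     (\<forall>f\<in>{1..n}. \<forall>h\<in>{1..n}. \<sigma> f < \<sigma> h \<longrightarrow>
        (\<forall>p. G Zero (two p f h) n = 0) \<and> G Plus (TwoP f h) n = 0 \<and>
        G Plus (Two f h) n = F (Ind f) (IndP h) n - x_c * F Plus (Two f h) n) \<and>
     (\<forall>p. \<forall>c\<in>{1..n}. \<forall>f\<in>{1..n}. \<forall>h\<in>{1..n}. c \<le> f \<and> \<sigma> f < \<sigma> h \<and> \<not> (\<sigma> f < \<sigma> c \<and> \<sigma> c \<le> \<sigma> h) \<longrightarrow>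
        G (Ind c) (two p f h) n = F (Ind c) (two p f h) n) \<and>
     (\<forall>p. \<forall>c\<in>{1..n}. \<forall>f\<in>{1..n}. c < f \<and> \<sigma> f < \<sigma> c \<longrightarrow>
        G (Ind c) (two p f c) n + G (Ind f) (base p) c = F (Ind f) (base p) c) \<and>
     (\<forall>p. \<forall>c\<in>{1..n}. \<forall>f\<in>{1..n}. \<forall>h\<in>{1..n}. c < f \<and> \<sigma> f < \<sigma> c \<and> \<sigma> c < \<sigma> h \<longrightarrow>
        G (Ind c) (two p f h) n + G (Ind f) (two p c h) n = F (Ind f) (two p c h) n)"

lemma intertwinedD:
  assumes "intertwined F G"
  shows "G Zero Zero j = F Zero Zero n"
    "j \<le> n \<Longrightarrow> G Plus Zero j = F Zero Plus n + (\<Sum>i\<in>{1..j}. F (Ind i) (IndP i) n) - x_c * F Plus Zero j"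
    "G Zero Plus j = F Plus Zero n" "G Plus Plus j = F Plus Plus n"
    "i \<in> {1..n} \<Longrightarrow> i \<le> j \<Longrightarrow> j \<le> n \<Longrightarrow> G (Ind i) (base p) j = F (Ind i) (base p) j"
    "k \<in> {1..n} \<Longrightarrow> G Zero (IndP k) n = 0" "k \<in> {1..n} \<Longrightarrow> G Plus (IndP k) n = F Plus (IndP k) n"
    "i \<in> {1..n} \<Longrightarrow> k \<in> {1..n} \<Longrightarrow> G (Ind i) (IndP k) n = up3 i (Ind k) (F Plus)"
    "f \<in> {1..n} \<Longrightarrow> h \<in> {1..n} \<Longrightarrow> \<sigma> f < \<sigma> h \<Longrightarrow> G Zero (two p f h) n = 0"
    "f \<in> {1..n} \<Longrightarrow> h \<in> {1..n} \<Longrightarrow> \<sigma> f < \<sigma> h \<Longrightarrow> G Plus (TwoP f h) n = 0"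
    "f \<in> {1..n} \<Longrightarrow> h \<in> {1..n} \<Longrightarrow> \<sigma> f < \<sigma> h \<Longrightarrow>
       G Plus (Two f h) n = F (Ind f) (IndP h) n - x_c * F Plus (Two f h) n"
    "c \<in> {1..n} \<Longrightarrow> f \<in> {1..n} \<Longrightarrow> h \<in> {1..n} \<Longrightarrow> c \<le> f \<Longrightarrow> \<sigma> f < \<sigma> h \<Longrightarrow>
       \<sigma> f < \<sigma> c \<Longrightarrow> \<sigma> h < \<sigma> c \<Longrightarrow> G (Ind c) (two p f h) n = F (Ind c) (two p f h) n"
    "c \<in> {1..n} \<Longrightarrow> f \<in> {1..n} \<Longrightarrow> h \<in> {1..n} \<Longrightarrow> c \<le> f \<Longrightarrow> \<sigma> f < \<sigma> h \<Longrightarrow>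
       \<sigma> c \<le> \<sigma> f \<Longrightarrow> G (Ind c) (two p f h) n = F (Ind c) (two p f h) n"
    "c \<in> {1..n} \<Longrightarrow> f \<in> {1..n} \<Longrightarrow> c < f \<Longrightarrow> \<sigma> f < \<sigma> c \<Longrightarrow>
       G (Ind c) (two p f c) n + G (Ind f) (base p) c = F (Ind f) (base p) c"
    "c \<in> {1..n} \<Longrightarrow> f \<in> {1..n} \<Longrightarrow> h \<in> {1..n} \<Longrightarrow> c < f \<Longrightarrow> \<sigma> f < \<sigma> c \<Longrightarrow> \<sigma> c < \<sigma> h \<Longrightarrow>
       G (Ind c) (two p f h) n + G (Ind f) (two p c h) n = F (Ind f) (two p c h) n"
  using assms unfolding intertwined_def by auto

section \<open>Exchange identities for a single row\<close>

context
  fixes F G :: "label \<Rightarrow> label \<Rightarrow> nat \<Rightarrow> int poly" and a :: label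
  assumes F: "left_relations F" and G: "intertwined F G" and a: "a \<in> labels n \<sigma>"
begin

lemmas G_eqs = intertwinedD[OF G]

lemma up2_Zero: "up2 a (G Zero) = (if a = Zero then F Plus Zero n else 0)"
  using a by cases (simp_all add: G_eqs up2_Ind)

lemma up2_Plus: "up2 a (G Plus) = up2 a (F Plus)"
  using a by cases (simp_all add: G_eqs up2_Ind)

text \<open>For \<open>a = Zero\<close> the sum is evaluated by \<open>sum_up3\<close>; for
  \<open>a = Ind i\<close> the value of \<open>G (Ind k) (IndP i)\<close> in
  \<open>intertwined\<close> is designed to give this identity.\<close>

lemma up2_carry:
  assumes "k \<in> {1..n}"
  shows "up2 a (G (Ind k)) = rsum a Plus (\<lambda>t r. up3 k r (F t))"
  using a by cases (use assms sum_up3[OF F, of k n True] in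
    \<open>simp_all add: G_eqs(8) G_eqs(5)[of k n True, simplified] up2_Ind rsum_Zero_Plus rsum_Ind_Plus\<close>)

lemma up3_Zero:
  assumes "k \<in> {1..n}"
  shows "up3 k a (G Zero) = (if a = Ind k then F Zero Zero n else if a = IndP k then F Plus Zero n else 0)"
  using a by cases (use assms in \<open>auto simp: G_eqs(1,3) G_eqs(9)[of _ _ False, simplified]
    G_eqs(9)[of _ _ True, simplified] up3_Ind up3_IndP\<close>)

text \<open>For \<open>a = Zero\<close> the tile of weight \<open>x_c\<close> cancels against the
  contribution of the left-sheared tile of weight \<open>- x_c\<close>. For \<open>a = Ind k\<close>
  the truncation at \<open>k\<close> of the sum in \<open>G Plus Zero k\<close> matches the
  condition \<open>i \<le> j\<close> on the right-sheared tiles.\<close>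

lemma up3_Plus:
  assumes "k \<in> {1..n}"
  shows "up3 k a (G Plus) = rsum a (Ind k) (\<lambda>t r. up2 r (F t)) - x_c * rsum a Plus (\<lambda>t r. up3 k r (F t))"
  using a
proof cases
  case 1
  then show ?thesis
    using assms sum_up3[OF F, of k n True]
    by (simp add: rsum_Zero_Plus rsum_Zero_Ind)
next
  case (3 g)
  then show ?thesis
    using assms by (auto simp: rsum_one_Ind[of _ _ False, simplified] rsum_Ind_Plus G_eqs(2,11) up3_Ind up2_Ind)
next
  case (4 g)
  then show ?thesis
    using assms by (auto simp: rsum_one_Ind[of _ _ True, simplified] G_eqs(4,10) up3_IndP)
qed simp_all

text \<open>The core exchange: the left-hand side collects the two tiles of
  \<open>lsum_one_Ind\<close> in a right column, \<open>left3\<close> is the corresponding row of a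
  left column. The cases are the relative orders of \<open>i\<close>, \<open>k\<close> and of
  \<open>\<sigma> i\<close>, \<open>\<sigma> k\<close>.\<close>

lemma up3_carry:
  assumes i: "i \<in> {1..n}" and k: "k \<in> {1..n}"
  shows "(if k \<le> i then up3 i a (G (Ind k)) else 0) + (if \<sigma> i < \<sigma> k then up3 k a (G (Ind i)) else 0)
    = left3 F k i a"
  using a
proof (cases rule: labels_shade_cases)
  case (2 p g)
  consider "k = i" | "k < i" "\<sigma> k < \<sigma> i" | "k < i" "\<sigma> i < \<sigma> k" | "i < k" "\<sigma> i < \<sigma> k" | "i < k" "\<sigma> k < \<sigma> i"
    using sigma_eq by (metis linorder_neqE_nat)
  then show ?thesis
  proof cases
    case 1
    then show ?thesis
      using 2 i k sum_up3[OF F, of i i p]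
      by (auto simp: left3_one up3_one G_eqs)
  next
    case 2
    then show ?thesis
      using \<open>a = _\<close> \<open>g \<in> _\<close> i k sum_up3[OF F, of k i p]
      by (auto simp: left3_one up3_one G_eqs(5,12,13) left_relations_two[OF F])
  next
    \<comment> \<open>Only in this inverted case can both terms occur. The sums prescribed by
      \<open>intertwined\<close> serve \<open>g = k\<close> and
      \<open>\<sigma> k < \<sigma> g\<close>; if \<open>\<sigma> g\<close> lies strictly between
      \<open>\<sigma> i\<close> and \<open>\<sigma> k\<close>, the remaining value of
      \<open>G\<close> equals one of \<open>F\<close> that vanishes by the first relation.\<close>
    case 3
    then show ?thesis
      using \<open>a = _\<close> \<open>g \<in> _\<close> i k sum_up3[OF F, of k i p] linorder_less_linear[of "\<sigma> g" "\<sigma> k"]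
      by (auto simp: left3_one up3_one G_eqs(5,12,13,14,15) left_relations_two[OF F])
  next
    case 4
    then show ?thesis
      using \<open>a = _\<close> \<open>g \<in> _\<close> i k sum_up3_below[OF F, of k i p]
      by (auto simp: left3_one up3_one G_eqs(5,12,13) left_relations_two[OF F])
  next
    case 5
    then show ?thesis
      using left3_swap[OF F a i k] by simp
  qed
qed (use i in \<open>simp_all add: left3_other\<close>)

lemma rsum_carry:
  assumes "i \<in> {1..n}"
  shows "rsum a Zero (\<lambda>t r. up3 i r (F t)) = (if a = Zero then F (Ind i) Zero n else 0)"
    "rsum a Plus (\<lambda>t r. up3 i r (F t)) = up2 a (G (Ind i))"
    "rsum a (Ind i) (\<lambda>t r. up2 r (F t)) = up3 i a (G Plus) + x_c * up2 a (G (Ind i))"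
    "rsum a (Ind i) (\<lambda>t r. if r = Zero then F t Zero n else 0)
       = up3 i a (G Zero) + (if a = Zero then x_c * F (Ind i) Zero n else 0)"
proof -
  show "rsum a Plus (\<lambda>t r. up3 i r (F t)) = up2 a (G (Ind i))"
    using assms by (simp add: up2_carry)
  show "rsum a (Ind i) (\<lambda>t r. up2 r (F t)) = up3 i a (G Plus) + x_c * up2 a (G (Ind i))"
    using assms by (simp add: up2_carry up3_Plus)
  show "rsum a Zero (\<lambda>t r. up3 i r (F t)) = (if a = Zero then F (Ind i) Zero n else 0)"
    using a by cases (use assms sum_up3[OF F, of i n False] in \<open>simp_all add: rsum_Zero_Zero\<close>)
  show "rsum a (Ind i) (\<lambda>t r. if r = Zero then F t Zero n else 0)
       = up3 i a (G Zero) + (if a = Zero then x_c * F (Ind i) Zero n else 0)"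
    unfolding up3_Zero[OF assms]
    using a by cases (use assms in \<open>auto simp: rsum_Zero_Ind
      rsum_one_Ind[of _ _ False, simplified] rsum_one_Ind[of _ _ True, simplified]\<close>)
qed

lemma rsum_base:
  "rsum a Zero (\<lambda>t r. if r = Zero then F t Zero n else 0) = (if a = Zero then F Zero Zero n else 0)"
  "rsum a Zero (\<lambda>t r. up2 r (F t)) = (if a = Zero then G Plus Zero n + x_c * F Plus Zero n else 0)"
  "rsum a Plus (\<lambda>t r. if r = Zero then F t Zero n else 0) = (if a = Zero then F Plus Zero n else 0)"
  "rsum a Plus (\<lambda>t r. up2 r (F t)) = up2 a (F Plus)"
  using a by (cases; simp add: rsum_Zero_Zero rsum_Zero_Plus rsum_Ind_Plus up2_Ind G_eqs)+

section \<open>The conditions of \<open>intertwined\<close> after prepending a row\<close>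

context
  fixes b :: label
  assumes b: "b \<in> labels n \<sigma>"
begin

abbreviation "F' \<equiv> lstep F a b"
abbreviation "G' \<equiv> rstep G a b"

lemmas step_simps = rstep_def lstep_def rsum_base rsum_carry lsum_simps dsum_simps

lemma step_Zero_Zero: "G' Zero Zero j = F' Zero Zero n"
  using b by cases (simp_all add: step_simps G_eqs(1) G_eqs(5)[of _ _ False, simplified])

lemma step_Plus_Zero:
  assumes "j \<le> n"
  shows "G' Plus Zero j = F' Zero Plus n + (\<Sum>i\<in>{1..j}. F' (Ind i) (IndP i) n) - x_c * F' Plus Zero j"
  using b
proof cases
  \<comment> \<open>The label \<open>b = Ind k\<close> selects the summand \<open>i = k\<close>, so
    truncating the sum at \<open>j\<close> has the effect of the bound \<open>j\<close> on the SE
    edge in the right column.\<close>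
  case (3 k)
  have "(\<Sum>i\<in>{1..j}. F' (Ind i) (IndP i) n) = (\<Sum>i\<in>{1..j}. if k = i then F' (Ind k) (IndP k) n else 0)"
    using 3 assms by (intro sum.cong) (auto simp: step_simps)
  also have "\<dots> = (if k \<le> j then F' (Ind k) (IndP k) n else 0)"
    using 3 by simp
  finally show ?thesis
    using 3 assms by (simp add: step_simps)
qed (use assms in \<open>simp_all add: step_simps G_eqs(5)[of _ _ False, simplified]\<close>)

lemma step_Zero_Plus: "G' Zero Plus j = F' Plus Zero n"
  using b by cases (simp_all add: step_simps up2_Zero)

lemma step_Plus_Plus: "G' Plus Plus j = F' Plus Plus n"
  using b by cases (simp_all add: step_simps up2_Plus)

lemma step_carry_base:
  assumes "i \<in> {1..n}" "i \<le> j" "j \<le> n"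
  shows "G' (Ind i) (base p) j = F' (Ind i) (base p) j"
  using b
proof (cases rule: labels_shade_cases)
  case (1 q)
  then show ?thesis
    using assms by (cases p; cases q) (simp_all add: step_simps G_eqs(5)[of _ _ False, simplified])
next
  case (2 q k)
  then show ?thesis
    using assms up3_carry[of i k] by (auto simp: rstep_def lstep_one lsum_one_Ind dsum_base_one)
next
  case (3 q f g)
  then show ?thesis
    by (simp add: rstep_def lstep_two_other lsum_none)
qed

lemma step_plussed:
  assumes "k \<in> {1..n}"
  shows "G' Zero (IndP k) n = 0" "G' Plus (IndP k) n = F' Plus (IndP k) n"
    "i \<in> {1..n} \<Longrightarrow> G' (Ind i) (IndP k) n = up3 i (Ind k) (F' Plus)"
proof -
  show "G' Zero (IndP k) n = 0"
    using b by cases (use assms in \<open>simp_all add: step_simps\<close>)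
  show "G' Plus (IndP k) n = F' Plus (IndP k) n"
    using b by cases (use assms in \<open>simp_all add: step_simps up2_Plus\<close>)
  show "G' (Ind i) (IndP k) n = up3 i (Ind k) (F' Plus)" if "i \<in> {1..n}"
    using b by cases (use assms that in \<open>auto simp: step_simps up3_Ind up2_Zero\<close>)
qed

lemma step_two:
  assumes "f \<in> {1..n}" "h \<in> {1..n}" "\<sigma> f < \<sigma> h"
  shows "G' Zero (two p f h) n = 0" "G' Plus (TwoP f h) n = 0"
    "G' Plus (Two f h) n = F' (Ind f) (IndP h) n - x_c * F' Plus (Two f h) n"
proof -
  show "G' Zero (two p f h) n = 0"
    using b by cases (use assms in \<open>cases p; simp add: step_simps\<close>)+
  show "G' Plus (TwoP f h) n = 0"
    using b by cases (use assms in \<open>simp_all add: step_simps\<close>)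
  show "G' Plus (Two f h) n = F' (Ind f) (IndP h) n - x_c * F' Plus (Two f h) n"
    using b by cases (use assms in \<open>auto simp: step_simps\<close>)
qed

text \<open>The last assumption rules out \<open>h = c\<close> and so leaves at most one fitting
  right-sheared tile when \<open>b\<close> has one index. If \<open>\<sigma> h < \<sigma> c\<close>,
  none fits, and \<open>left3_swap\<close> makes the left column's value vanish too.\<close>

lemma step_carry_two:
  assumes "c \<in> {1..n}" "f \<in> {1..n}" "h \<in> {1..n}" "c \<le> f" "\<sigma> f < \<sigma> h" "\<not> (\<sigma> f < \<sigma> c \<and> \<sigma> c \<le> \<sigma> h)"
  shows "G' (Ind c) (two p f h) n = F' (Ind c) (two p f h) n"
  using b
proof (cases rule: labels_shade_cases)
  case (1 q)
  then show ?thesis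
    using assms by (cases p; cases q) (auto simp: step_simps lstep_two_other)
next
  case (2 q k)
  then show ?thesis
    using assms up3_carry[of c f] left3_swap[OF F a, of c f] sigma_eq[of c f]
    by (auto simp: rstep_def lstep_one lsum_one_Ind dsum_two split: if_splits)
next
  case (3 q k l)
  then show ?thesis
    by (simp add: rstep_def lstep_two_other lsum_none)
qed

text \<open>Each value provides one of the two terms of \<open>up3_carry\<close>: in the second
  value the bound \<open>c\<close> blocks the SE index \<open>f\<close>, which leaves only the other
  tile.\<close>

lemma step_inversion_same:
  assumes "c \<in> {1..n}" "f \<in> {1..n}" "c < f" "\<sigma> f < \<sigma> c"
  shows "G' (Ind c) (two p f c) n + G' (Ind f) (base p) c = F' (Ind f) (base p) c"
  using b
proof (cases rule: labels_shade_cases)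
  case (1 q)
  then show ?thesis
    using assms by (cases p; cases q) (auto simp: step_simps G_eqs(5)[of _ _ False, simplified])
next
  case (2 q k)
  then show ?thesis
    using assms up3_carry[of f k]
    by (auto simp: rstep_def lstep_one lsum_one_Ind dsum_two dsum_base_one)
next
  case (3 q k l)
  then show ?thesis
    by (simp add: rstep_def lstep_two_other lsum_none)
qed

text \<open>Again each value contributes one term of \<open>up3_carry\<close>, now with carried
  index \<open>f\<close> and family index \<open>c\<close>.\<close>

lemma step_inversion:
  assumes "c \<in> {1..n}" "f \<in> {1..n}" "h \<in> {1..n}" "c < f" "\<sigma> f < \<sigma> c" "\<sigma> c < \<sigma> h"
  shows "G' (Ind c) (two p f h) n + G' (Ind f) (two p c h) n = F' (Ind f) (two p c h) n"
  using b
proof (cases rule: labels_shade_cases)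
  case (1 q)
  then show ?thesis
    using assms by (cases p; cases q) (auto simp: step_simps)
next
  case (2 q k)
  then show ?thesis
    using assms up3_carry[of f c]
    by (auto simp: rstep_def lstep_one lsum_one_Ind dsum_two)
next
  case (3 q k l)
  then show ?thesis
    by (simp add: rstep_def lstep_two_other lsum_none)
qed

lemma intertwined_step: "intertwined F' G'"
  unfolding intertwined_def
  using step_Zero_Zero step_Plus_Zero step_Zero_Plus step_Plus_Plus step_carry_base
    step_plussed step_two step_carry_two step_inversion_same step_inversion
  by (intro conjI allI ballI impI) auto

end
end

section \<open>Partition functions as iterated transfer\<close>

text \<open>The relation \<open>S\<close> encodes how the two tiles of a row meet each other and the
  outer labels; varying only \<open>S\<close> lets both columns share one path formalism.\<close>

definition joints :: "(rtile \<Rightarrow> diamond \<Rightarrow> bool) \<Rightarrow> label \<Rightarrow> label \<Rightarrow> nat \<Rightarrow> (rtile \<times> diamond) set" where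
  "joints S c d j = {(Q, D). Q \<in> rtiles n \<sigma> \<and> D \<in> diamonds n \<sigma> \<and> S Q D \<and>
     rbottom Q = c \<and> SW D = d \<and> \<not> blocked j d (SE D)}"

primrec paths :: "(rtile \<Rightarrow> diamond \<Rightarrow> bool) list \<Rightarrow> label \<Rightarrow> label \<Rightarrow> nat \<Rightarrow> (rtile list \<times> diamond list) set" where
  "paths [] c d j = {([], [])}"
| "paths (S # Ss) c d j = (\<Union>(Q, D) \<in> joints S c d j.
     (\<lambda>(Qs, Ds). (Q # Qs, D # Ds)) ` paths Ss (rtop Q) (NE D) (limit n D))"

primrec transfer :: "(label \<Rightarrow> label \<Rightarrow> int poly) \<Rightarrow> (rtile \<Rightarrow> diamond \<Rightarrow> bool) list \<Rightarrow> label \<Rightarrow> label \<Rightarrow> nat \<Rightarrow> int poly" where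
  "transfer \<phi> [] c d j = \<phi> c d"
| "transfer \<phi> (S # Ss) c d j = (\<Sum>(Q, D) \<in> joints S c d j. rweight Q * transfer \<phi> Ss (rtop Q) (NE D) (limit n D))"

lemma finite_joints: "finite (joints S c d j)"
  by (rule finite_subset[of _ "rtiles n \<sigma> \<times> diamonds n \<sigma>"])
    (auto simp: joints_def finite_rtiles finite_diamonds)

lemma finite_paths: "finite (paths Ss c d j)"
  by (induction Ss arbitrary: c d j) (auto simp: finite_joints)

text \<open>Prepending the start labels before taking \<open>last\<close> also gives final labels
  for the empty column, where the induction begins.\<close>

lemma sum_paths:
  "(\<Sum>(Q, D) \<in> paths Ss c d j. prod_list (map rweight Q) * \<phi> (last (c # map rtop Q)) (last (d # map NE D)))
    = transfer \<phi> Ss c d j"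
proof (induction Ss arbitrary: c d j)
  case (Cons S Ss)
  let ?w = "\<lambda>c d (Q, D). prod_list (map rweight Q) * \<phi> (last (c # map rtop Q)) (last (d # map NE D))"
  have "sum (?w c d) (paths (S # Ss) c d j)
    = (\<Sum>(Q, D) \<in> joints S c d j. sum (?w c d) ((\<lambda>(Qs, Ds). (Q # Qs, D # Ds)) ` paths Ss (rtop Q) (NE D) (limit n D)))"
    unfolding paths.simps
    by (subst sum.UNION_disjoint) (auto simp: finite_joints finite_paths case_prod_unfold)
  also have "\<dots> = (\<Sum>(Q, D) \<in> joints S c d j. rweight Q * sum (?w (rtop Q) (NE D)) (paths Ss (rtop Q) (NE D) (limit n D)))"
  proof (rule sum.cong[OF refl], clarify)
    fix Q :: rtile and D :: diamond
    have "inj_on (\<lambda>(Qs, Ds). (Q # Qs, D # Ds)) A" for A :: "(rtile list \<times> diamond list) set"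
      by (auto simp: inj_on_def)
    then show "sum (?w c d) ((\<lambda>(Qs, Ds). (Q # Qs, D # Ds)) ` paths Ss (rtop Q) (NE D) (limit n D))
        = rweight Q * sum (?w (rtop Q) (NE D)) (paths Ss (rtop Q) (NE D) (limit n D))"
      by (simp add: sum.reindex sum_distrib_left mult.assoc case_prod_unfold)
  qed
  finally show ?case
    unfolding Cons.IH transfer.simps .
qed simp

lemma paths_Cons_iff:
  "(x, y) \<in> paths (S # Ss) c d j \<longleftrightarrow> (\<exists>Q Qs D Ds. x = Q # Qs \<and> y = D # Ds \<and> (Q, D) \<in> joints S c d j \<and>
     (Qs, Ds) \<in> paths Ss (rtop Q) (NE D) (limit n D))"
  by (force simp: image_iff)

lemma paths_iff:
  "(Q, D) \<in> paths Ss c d j \<longleftrightarrow> length Q = length Ss \<and> length D = length Ss \<and>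
     (\<forall>i<length Ss. (Q ! i, D ! i) \<in>
        joints (Ss ! i) ((c # map rtop Q) ! i) ((d # map NE D) ! i) ((j # map (limit n) D) ! i))"
proof (induction Ss arbitrary: Q D c d j)
  case (Cons S Ss)
  show ?case
    unfolding paths_Cons_iff
    by (cases Q; cases D) (auto simp: Cons.IH All_less_Suc2)
qed auto

lemma paths_Suc_iff:
  assumes "length Ss = Suc k"
  shows "(Q, D) \<in> paths Ss c d j \<longleftrightarrow> length Q = Suc k \<and> length D = Suc k \<and>
     set Q \<subseteq> rtiles n \<sigma> \<and> set D \<subseteq> diamonds n \<sigma> \<and> (\<forall>i<Suc k. (Ss ! i) (Q ! i) (D ! i)) \<and>
     rbottom (Q ! 0) = c \<and> SW (D ! 0) = d \<and> \<not> blocked j d (SE (D ! 0)) \<and>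
     (\<forall>i. Suc i < Suc k \<longrightarrow> rtop (Q ! i) = rbottom (Q ! Suc i) \<and> NE (D ! i) = SW (D ! Suc i) \<and>
       \<not> blocked (limit n (D ! i)) (NE (D ! i)) (SE (D ! Suc i)))"
proof (cases "length Q = Suc k \<and> length D = Suc k")
  case True
  then show ?thesis
    using assms unfolding paths_iff joints_def subset_eq all_set_conv_all_nth
    by (auto simp: All_less_Suc2)
qed (auto simp: paths_iff assms)

lemma transfer_left:
  "transfer \<phi> ((\<lambda>Q D. rleft Q = a \<and> rright Q = NW D \<and> SE D = b) # Ss) = lstep (transfer \<phi> Ss) a b"
proof (intro ext)
  fix c d j
  have "joints (\<lambda>Q D. rleft Q = a \<and> rright Q = NW D \<and> SE D = b) c d j
    = (if blocked j d b then {} else Sigma {Q. Q \<in> rtiles n \<sigma> \<and> rleft Q = a \<and> rbottom Q = c}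
         (\<lambda>Q. {D. D \<in> diamonds n \<sigma> \<and> NW D = rright Q \<and> SW D = d \<and> SE D = b}))"
    by (auto simp: joints_def)
  then show "transfer \<phi> ((\<lambda>Q D. rleft Q = a \<and> rright Q = NW D \<and> SE D = b) # Ss) c d j
    = lstep (transfer \<phi> Ss) a b c d j"
    by (simp add: lstep_def rsum_def dsum_def sum.Sigma[symmetric] finite_rtiles finite_diamonds sum_distrib_left)
qed

lemma transfer_right:
  "transfer \<phi> ((\<lambda>Q D. NW D = a \<and> SE D = rleft Q \<and> rright Q = b) # Ss) = rstep (transfer \<phi> Ss) a b"
proof (intro ext)
  fix c d j
  have "joints (\<lambda>Q D. NW D = a \<and> SE D = rleft Q \<and> rright Q = b) c d j
    = Sigma {Q. Q \<in> rtiles n \<sigma> \<and> rright Q = b \<and> rbottom Q = c}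
         (\<lambda>Q. if blocked j d (rleft Q) then {} else {D. D \<in> diamonds n \<sigma> \<and> NW D = a \<and> SW D = d \<and> SE D = rleft Q})"
    by (auto simp: joints_def split: if_splits)
  then show "transfer \<phi> ((\<lambda>Q D. NW D = a \<and> SE D = rleft Q \<and> rright Q = b) # Ss) c d j
    = rstep (transfer \<phi> Ss) a b c d j"
    by (auto simp: rstep_def lsum_def dsum_def sum.Sigma[symmetric] finite_rtiles finite_diamonds sum_distrib_left
        intro!: sum.cong)
qed

section \<open>Tilings as paths\<close>

lemma SE_diamond:
  assumes "D \<in> diamonds n \<sigma>"
  shows "SE D = Zero \<or> (\<exists>p. \<exists>h\<in>{1..n}. SE D = one p h)"
  using assms by cases (auto simp: lower2_def lower3_iff ex_bool_eq)

lemma not_blocked_start: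
  assumes "D \<in> diamonds n \<sigma>"
  shows "\<not> blocked n d (SE D)"
  using SE_diamond[OF assms] by (auto simp: blocked_def) (auto simp: one_def split: if_splits)

text \<open>The range conditions in \<open>banned\<close> hold automatically for diamond tiles, and
  the default bound \<open>n\<close> blocks nothing because SE indices are at most
  \<open>n\<close>.\<close>

lemma banned_iff_blocked:
  assumes D: "D \<in> diamonds n \<sigma>" and D': "D' \<in> diamonds n \<sigma>" and eq: "NE D = SW D'"
  shows "banned n D D' \<longleftrightarrow> blocked (limit n D) (NE D) (SE D')"
proof -
  have limit: "limit n D = i" if "NE D = base p" "NW D = one p i" for p i
    using that by (cases p) (simp_all add: limit_def)
  have no_limit: "limit n D = n" if "NE D = base p" "\<And>i. NW D \<noteq> one p i" for p
    using that by (cases p) (auto simp: limit_def split: label.splits)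
  have ge1: "1 \<le> i" if "NE D = base p" "NW D = one p i" for p i
    using D that by cases (cases p; auto simp: upper2_def upper3_def)+
  have le: "h \<le> n" if "SE D' = one p h" for p h
    using SE_diamond[OF D'] that by (auto simp: one_def split: if_splits)
  have "banned n D D' \<longleftrightarrow> (\<exists>p i h. 1 \<le> i \<and> i < h \<and> h \<le> n \<and>
      NE D = base p \<and> NW D = one p i \<and> SE D' = one p h)"
    using eq by (auto simp: banned_def ex_bool_eq)
  also have "\<dots> \<longleftrightarrow> (\<exists>p h. NE D = base p \<and> SE D' = one p h \<and> limit n D < h)"
    by (metis limit no_limit ge1 le not_less)
  finally show ?thesis
    by (auto simp: blocked_def)
qed

text \<open>The bottom diamond has no predecessor, which the initial bound \<open>n\<close>
  expresses.\<close>

lemma paths_start_iff: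
  assumes "length Ss = Suc k"
  shows "(Q, D) \<in> paths Ss c d n \<longleftrightarrow> length Q = Suc k \<and> length D = Suc k \<and>
     set Q \<subseteq> rtiles n \<sigma> \<and> set D \<subseteq> diamonds n \<sigma> \<and> (\<forall>i<Suc k. (Ss ! i) (Q ! i) (D ! i)) \<and>
     rbottom (Q ! 0) = c \<and> SW (D ! 0) = d \<and>
     (\<forall>i. Suc i < Suc k \<longrightarrow> rtop (Q ! i) = rbottom (Q ! Suc i) \<and> NE (D ! i) = SW (D ! Suc i) \<and>
       \<not> banned n (D ! i) (D ! Suc i))"
proof (cases "length D = Suc k \<and> set D \<subseteq> diamonds n \<sigma>")
  case True
  then have D: "D ! i \<in> diamonds n \<sigma>" if "i < Suc k" for i
    using that by (metis nth_mem subsetD)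
  have "(\<forall>i. Suc i < Suc k \<longrightarrow> rtop (Q ! i) = rbottom (Q ! Suc i) \<and> NE (D ! i) = SW (D ! Suc i) \<and>
       \<not> blocked (limit n (D ! i)) (NE (D ! i)) (SE (D ! Suc i))) \<longleftrightarrow>
     (\<forall>i. Suc i < Suc k \<longrightarrow> rtop (Q ! i) = rbottom (Q ! Suc i) \<and> NE (D ! i) = SW (D ! Suc i) \<and>
       \<not> banned n (D ! i) (D ! Suc i))"
    using banned_iff_blocked[OF D D] by (metis Suc_lessD)
  then show ?thesis
    by (simp only: paths_Suc_iff[OF assms] not_blocked_start[OF D] zero_less_Suc simp_thms)
qed (auto simp: paths_Suc_iff[OF assms])

abbreviation "left_rel q t \<equiv> map (\<lambda>(a, b) Q D. rleft Q = a \<and> rright Q = NW D \<and> SE D = b) (zip q t)"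
abbreviation "right_rel q t \<equiv> map (\<lambda>(a, b) Q D. NW D = a \<and> SE D = rleft Q \<and> rright Q = b) (zip q t)"

lemma left_tilings_paths:
  assumes "m \<ge> 1" "length q = m" "length t = m"
  shows "left_tilings n \<sigma> m q r s t u v = {(P, Q, D). P \<in> ltiles n \<and> lleft P = r \<and> lbottom P = s \<and>
    (Q, D) \<in> paths (left_rel q t) (ltop P) (lright P) n \<and>
    last (ltop P # map rtop Q) = v \<and> last (lright P # map NE D) = u}"
proof -
  obtain k where m: "m = Suc k" using assms by (cases m) auto
  have len: "length (left_rel q t) = Suc k" using assms m by simp
  have "last (c # map rtop Q) = rtop (Q ! k)" "last (d # map NE D) = NE (D ! k)"
    if "length Q = Suc k" "length D = Suc k" for Q D c d
    using that by (auto simp: last_map last_conv_nth)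
  then show ?thesis
    unfolding left_tilings_def m paths_start_iff[OF len]
    using assms m by (auto simp del: last.simps)
qed

lemma right_tilings_paths:
  assumes "m \<ge> 1" "length q = m" "length t = m"
  shows "right_tilings n \<sigma> m q r s t u v = {(P, Q, D). P \<in> ltiles n \<and> ltop P = v \<and> lright P = u \<and>
    (Q, D) \<in> paths (right_rel q t) s r n \<and>
    last (s # map rtop Q) = lbottom P \<and> last (r # map NE D) = lleft P}"
proof -
  obtain k where m: "m = Suc k" using assms by (cases m) auto
  have len: "length (right_rel q t) = Suc k" using assms m by simp
  have "last (c # map rtop Q) = rtop (Q ! k)" "last (d # map NE D) = NE (D ! k)"
    if "length Q = Suc k" "length D = Suc k" for Q D c d
    using that by (auto simp: last_map last_conv_nth)
  then show ?thesis
    unfolding right_tilings_def m paths_start_iff[OF len]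
    using assms m by (auto simp del: last.simps)
qed

lemma left_partition_transfer:
  assumes "m \<ge> 1" "length q = m" "length t = m"
  shows "left_partition n \<sigma> m q r s t u v = (\<Sum>P | P \<in> ltiles n \<and> lleft P = r \<and> lbottom P = s.
    lweight P * transfer (\<lambda>c d. of_bool (c = v \<and> d = u)) (left_rel q t) (ltop P) (lright P) n)"
proof -
  let ?W = "\<lambda>P (Q, D). lweight P * (prod_list (map rweight Q) *
    of_bool (last (ltop P # map rtop Q) = v \<and> last (lright P # map NE D) = u))"
  let ?A = "{P \<in> ltiles n. lleft P = r \<and> lbottom P = s}"
  let ?B = "\<lambda>P. paths (left_rel q t) (ltop P) (lright P) n"
  \<comment> \<open>The conditions on the final labels become a 0-1 factor, so the sum may be
    extended to all paths.\<close>
  have "left_partition n \<sigma> m q r s t u v = (\<Sum>(P, x) \<in> Sigma ?A ?B. ?W P x)"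
    unfolding left_partition_def left_tilings_paths[OF assms]
    by (rule sum.mono_neutral_cong_left)
      (auto simp: finite_ltiles finite_paths tiling_weight_def simp del: last.simps)
  also have "\<dots> = (\<Sum>P\<in>?A. \<Sum>x\<in>?B P. ?W P x)"
    by (simp add: sum.Sigma finite_ltiles finite_paths)
  also have "\<dots> = (\<Sum>P\<in>?A. lweight P * transfer (\<lambda>c d. of_bool (c = v \<and> d = u)) (left_rel q t) (ltop P) (lright P) n)"
    by (simp add: sum_paths[symmetric] sum_distrib_left case_prod_unfold del: last.simps)
  finally show ?thesis .
qed

text \<open>Here the left-sheared tile comes last and is absorbed into the end function, evaluated
  at the final labels of the path.\<close>

lemma right_partition_transfer:
  assumes "m \<ge> 1" "length q = m" "length t = m"
  shows "right_partition n \<sigma> m q r s t u v =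
    transfer (\<lambda>c d. \<Sum>P | P \<in> ltiles n \<and> lbottom P = c \<and> lleft P = d \<and> ltop P = v \<and> lright P = u. lweight P)
      (right_rel q t) s r n"
proof -
  let ?A = "\<lambda>(Q, D). {P \<in> ltiles n. lbottom P = last (s # map rtop Q) \<and> lleft P = last (r # map NE D) \<and>
     ltop P = v \<and> lright P = u}"
  let ?B = "paths (right_rel q t) s r n"
  have "right_tilings n \<sigma> m q r s t u v = (\<lambda>(x, P). (P, x)) ` Sigma ?B ?A"
    unfolding right_tilings_paths[OF assms] by (auto simp: image_iff simp del: last.simps)
  then have "right_partition n \<sigma> m q r s t u v = (\<Sum>(x, P) \<in> Sigma ?B ?A. tiling_weight (P, x))"
    by (simp add: right_partition_def sum.reindex inj_on_def case_prod_unfold)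
  also have "\<dots> = (\<Sum>x\<in>?B. \<Sum>P\<in>?A x. tiling_weight (P, x))"
    by (subst sum.Sigma) (auto simp: finite_ltiles finite_paths case_prod_unfold)
  also have "\<dots> = (\<Sum>(Q, D)\<in>?B. prod_list (map rweight Q) *
      (\<Sum>P | P \<in> ltiles n \<and> lbottom P = last (s # map rtop Q) \<and> lleft P = last (r # map NE D) \<and>
         ltop P = v \<and> lright P = u. lweight P))"
    by (intro sum.cong refl)
      (auto simp: tiling_weight_def sum_distrib_left mult.commute simp del: last.simps)
  finally show ?thesis
    unfolding sum_paths[symmetric] .
qed

section \<open>Empty columns and the induction over rows\<close>

abbreviation "left_end u v c d \<equiv> of_bool (c = v \<and> d = u)"
abbreviation "right_end u v c d \<equiv>
  (\<Sum>P | P \<in> ltiles n \<and> lbottom P = c \<and> lleft P = d \<and> ltop P = v \<and> lright P = u. lweight P)"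

lemma right_end_eq:
  "right_end u v c d = (if LTile v u d c \<in> ltiles n then lweight (LTile v u d c) else 0)"
proof -
  have "{P. P \<in> ltiles n \<and> lbottom P = c \<and> lleft P = d \<and> ltop P = v \<and> lright P = u}
    = (if LTile v u d c \<in> ltiles n then {LTile v u d c} else {})"
    by (auto split: if_splits)
  then show ?thesis by simp
qed

lemma left_relations_end:
  assumes "u \<in> {Zero, Plus}"
  shows "left_relations (\<lambda>c d j. left_end u v c d)"
  using assms by (auto simp: left_relations_def two_def)

text \<open>For empty columns \<open>F\<close> is the indicator of \<open>(v, u)\<close> and
  \<open>G\<close> the weight of the left-sheared tile with the given edges, so the conditions
  restate the list of these tiles. As \<open>u\<close> is \<open>Zero\<close> or
  \<open>Plus\<close>, \<open>F\<close> vanishes at all other diamond labels.\<close>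

lemma intertwined_end:
  assumes "u \<in> {Zero, Plus}"
  shows "intertwined (\<lambda>c d j. left_end u v c d) (\<lambda>c d j. right_end u v c d)"
proof -
  have u: "two p f h \<noteq> u" "IndP i \<noteq> u" for p f h i
    using assms by (auto simp: two_def)
  have tiles:
    "LTile v u Zero Zero \<in> ltiles n \<longleftrightarrow> v = Zero \<and> u = Zero"
    "LTile v u Zero Plus \<in> ltiles n \<longleftrightarrow> v = Zero \<and> u = Plus \<or> v = Plus \<and> u = Zero"
    "LTile v u Plus Zero \<in> ltiles n \<longleftrightarrow> v = Plus \<and> u = Zero"
    "LTile v u Plus Plus \<in> ltiles n \<longleftrightarrow> v = Plus \<and> u = Plus"
    "LTile v u (IndP k) Zero \<notin> ltiles n" "LTile v u (IndP k) Plus \<notin> ltiles n"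
    "LTile v u (two p f h) c \<notin> ltiles n" for k p f h c
    using assms by (simp_all add: ltiles.simps two_def) auto
  have tiles_Ind:
    "LTile v u (base p) (Ind i) \<in> ltiles n \<longleftrightarrow> v = Ind i \<and> u = base p"
    "LTile v u (IndP k) (Ind i) \<in> ltiles n \<longleftrightarrow> v = Plus \<and> u = Zero \<and> i = k"
    if "i \<in> {1..n}" for i k p
    using assms that by (cases p; auto simp: ltiles.simps)+
  show ?thesis
    unfolding intertwined_def right_end_eq
    by (intro conjI allI ballI impI) (auto simp: tiles tiles(7)[of False, simplified]
        tiles(7)[of True, simplified] tiles_Ind tiles_Ind(1)[of _ False, simplified] u
        u(1)[of False, simplified] u(1)[of True, simplified] lweight_def up3_Ind)
qed

text \<open>The head of the lists is the bottom row, so the induction adds rows from below.\<close>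

lemma transfer_intertwined:
  assumes u: "u \<in> {Zero, Plus}"
    and "length q = length t" "set q \<subseteq> labels n \<sigma>" "set t \<subseteq> labels n \<sigma>"
  shows "left_relations (transfer (left_end u v) (left_rel q t)) \<and>
    intertwined (transfer (left_end u v) (left_rel q t)) (transfer (right_end u v) (right_rel q t))"
  using assms(2-)
proof (induction q t rule: list_induct2)
  case Nil
  have [simp]: "transfer \<phi> [] = (\<lambda>c d j. \<phi> c d)" for \<phi> by (intro ext) simp
  show ?case using left_relations_end[OF u] intertwined_end[OF u] by simp
next
  case (Cons a q b t)
  then show ?case
    by (simp add: transfer_left transfer_right left_relations_lstep intertwined_step)
qed

section \<open>The left-sheared tile at the bottom of the left column\<close>

lemma sum_ltiles:
  "(\<Sum>P | P \<in> ltiles n \<and> lleft P = r \<and> lbottom P = s. lweight P * K (ltop P) (lright P))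
    = (\<Sum>(x, y) | LTile x y r s \<in> ltiles n. lweight (LTile x y r s) * K x y)"
proof -
  have "{P \<in> ltiles n. lleft P = r \<and> lbottom P = s}
      = (\<lambda>(x, y). LTile x y r s) ` {(x, y). LTile x y r s \<in> ltiles n}"
    by (auto simp: image_iff) (metis ltile.collapse)
  then show ?thesis
    by (auto simp: sum.reindex inj_on_def case_prod_unfold)
qed

text \<open>At bound \<open>n\<close> and diamond label \<open>r\<close>, the conditions of
  \<open>intertwined\<close> become the sum over the left-sheared tiles with left edge
  \<open>r\<close> and bottom edge \<open>s\<close>.\<close>

lemma transfer_start:
  assumes u: "u \<in> {Zero, Plus}" and r: "r \<in> {Zero, Plus}" and s: "s \<in> labels n \<sigma>"
    and m: "length q = length t" "q \<noteq> []" and qt: "set q \<subseteq> labels n \<sigma>" "set t \<subseteq> labels n \<sigma>"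
  shows "(\<Sum>P | P \<in> ltiles n \<and> lleft P = r \<and> lbottom P = s.
      lweight P * transfer (left_end u v) (left_rel q t) (ltop P) (lright P) n)
    = transfer (right_end u v) (right_rel q t) s r n"
proof -
  define F where "F = transfer (left_end u v) (left_rel q t)"
  define G where "G = transfer (right_end u v) (right_rel q t)"
  have "intertwined F G"
    using transfer_intertwined[OF u m(1) qt] by (simp add: F_def G_def)
  note D = intertwinedD[OF this]
  obtain a q' b t' where "q = a # q'" "t = b # t'"
    using m by (cases q; cases t) auto
  \<comment> \<open>Neither a right-sheared nor a left-sheared tile has a plussed index or a
    two-index label at its bottom, so for such \<open>s\<close> both sides are 0.\<close>
  then have G0: "G (IndP i) d n = 0" "G (two p f g) d n = 0" for i p f g d
    by (simp_all add: G_def transfer_right rstep_def lsum_none)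
  have "(\<Sum>(x, y) | LTile x y r s \<in> ltiles n. lweight (LTile x y r s) * F x y n) = G s r n"
    using s
  proof cases
    case 1
    have *: "{(x, y). LTile x y r s \<in> ltiles n} = {(r, Zero)}"
      using 1 r by (auto simp: ltiles.simps)
    show ?thesis
      unfolding * using 1 r D(1,3) by (auto simp: lweight_def)
  next
    case 2
    show ?thesis
    proof (cases "r = Zero")
      case True
      have *: "{(x, y). LTile x y r s \<in> ltiles n}
          = insert (Zero, Plus) (insert (Plus, Zero) ((\<lambda>i. (Ind i, IndP i)) ` {1..n}))"
        using 2 True by (auto simp: ltiles.simps)
      \<comment> \<open>At bound \<open>n\<close> the truncated sum runs over all left-sheared tiles
        with top edge \<open>Ind i\<close> and right edge \<open>IndP i\<close>.\<close>
      show ?thesis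
        unfolding * using 2 True D(2)[of n]
        by (simp add: lweight_def image_iff sum.reindex inj_on_def)
    next
      case False
      then have *: "{(x, y). LTile x y r s \<in> ltiles n} = {(Plus, Plus)}"
        using 2 r by (auto simp: ltiles.simps)
      show ?thesis
        unfolding * using 2 r False D(4) by (auto simp: lweight_def)
    qed
  next
    case (3 i)
    then have *: "{(x, y). LTile x y r s \<in> ltiles n} = {(Ind i, r)}"
      using r by (auto simp: ltiles.simps)
    show ?thesis
      unfolding * using 3 r D(5)[of i n False] D(5)[of i n True] by (auto simp: lweight_def)
  next
    case (4 i)
    then have *: "{(x, y). LTile x y r s \<in> ltiles n} = {}"
      by (auto simp: ltiles.simps)
    show ?thesis unfolding * using 4 G0 by simp
  next
    case (5 f g)
    then have *: "{(x, y). LTile x y r s \<in> ltiles n} = {}"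
      by (auto simp: ltiles.simps)
    show ?thesis unfolding * using 5 G0(2)[of False] by simp
  next
    case (6 f g)
    then have *: "{(x, y). LTile x y r s \<in> ltiles n} = {}"
      by (auto simp: ltiles.simps)
    show ?thesis unfolding * using 6 G0(2)[of True] by simp
  qed
  from trans[OF sum_ltiles[where K = "\<lambda>x y. F x y n"] this] show ?thesis
    unfolding F_def G_def .
qed

end

theorem lemma6p3:
  fixes n m :: nat and \<sigma> :: "nat \<Rightarrow> nat"
    and q t :: "label list" and r s u v :: label
  assumes "n \<ge> 1" and "\<sigma> permutes {1..n}" and "m \<ge> 1"
    and "length q = m" and "set q \<subseteq> labels n \<sigma>"
    and "length t = m" and "set t \<subseteq> labels n \<sigma>"
    and "s \<in> labels n \<sigma>" and "v \<in> labels n \<sigma>"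
    and "r \<in> {Zero, Plus}" and "u \<in> {Zero, Plus}"
  shows "left_partition n \<sigma> m q r s t u v = right_partition n \<sigma> m q r s t u v"
proof -
  interpret column n \<sigma>
    using assms(2) by unfold_locales
  have "length q = length t" "q \<noteq> []"
    using assms by auto
  from transfer_start[OF \<open>u \<in> _\<close> \<open>r \<in> _\<close> \<open>s \<in> _\<close> this \<open>set q \<subseteq> _\<close> \<open>set t \<subseteq> _\<close>]
  show ?thesis
    by (simp only: left_partition_transfer right_partition_transfer assms)
qed

end
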